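(* Let $k\geq 2$ and $N\geq 1$. If a $k$-qubit unitary operation $U$ is deterministically implementable over the $(k,N)$-cluster network, then $U^M$ can be written as $$U^M=V_1^MV_2^M\cdots V_N^M,$$ where each $V_i^M$ ($1\le i\le N$) is a $2^k\times 2^k$ unitary matrix of the form $$V_i^M=\sum_{a_1=0}^1\sum_{a_2=0}^1\cdots\sum_{a_{k-1}=0}^1E^{(a_1)}_{1,i}\otimes E^{(a_1,a_2)}_{2,i}\otimes E^{(a_2,a_3)}_{3,i}\otimes\cdots\otimes E^{(a_{k-2},a_{k-1})}_{k-1,i}\otimes E^{(a_{k-1})}_{k,i},$$ with all $E^{(m)}_{1,i}, E^{(m,n)}_{r,i}, E^{(m)}_{k,i}$ being $2\times 2$ complex matrices.
   Context: The $(k,N)$-cluster network has nodes $v_{i,j}$ ($1\le i\le k$, $1\le j\le N$), input nodes $v_{i,1}$, output nodes $v_{i,N}$, vertical edges $\{v_{i,j},v_{i+1,j}\}$ ($1\le i\le k-1$, $1\le j\le N$) and horizontal edges $\{v_{i,j},v_{i,j+1}\}$ ($1\le i\le k$, $1\le j\le N-1$). Its resource state $|\Phi\rangle_{\mathcal R}$ is the tensor product over all edges of an EPR pair $|\Phi^+\rangle=(|00\rangle+|11\rangle)/\sqrt2$ whose two qubits sit at the two endpoints of that edge. Each input node $v_{i,1}$ holds one input qubit $I_i$ and each output node $v_{i,N}$ holds one output qubit $O_i$. A $k$-qubit unitary $U$ from the input qubits to the output qubits is deterministically implementable over the network if there is an LOCC map $\Gamma$ (finitely many rounds of local quantum operations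 — including adjoining ancillas and measurements — each acting only on systems located at a single node, interleaved with unrestricted classical communication between nodes) such that $\Gamma(|\psi\rangle\langle\psi|\otimes|\Phi\rangle\langle\Phi|_{\mathcal R})=U|\psi\rangle\langle\psi|U^\dagger$ for every pure state $|\psi\rangle$ of the input qubits. $U^M$ denotes the $2^k\times 2^k$ matrix of $U$ in the computational basis, tensor factors ordered by the row index $i=1,\dots,k$. *)

theory Defs
  imports Complex_Main
begin

(* Nodes v_{i,j} are pairs (i,j) with 1<=i<=k, 1<=j<=N.
   Each node carries a finite-dimensional Hilbert space C^(d v); a global
   computational basis vector is a function b :: node => nat with b v < d v
   (and b v = 0 off the network). Operators / density operators are given by
   their matrix entries indexed by such basis vectors. *)

type_synonym node = "nat \<times> nat"
type_synonym gidx = "node \<Rightarrow> nat"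
type_synonym gdens = "gidx \<Rightarrow> gidx \<Rightarrow> complex"
type_synonym bv = "nat \<Rightarrow> nat"
type_synonym odens = "bv \<Rightarrow> bv \<Rightarrow> complex"

definition nodes :: "nat \<Rightarrow> nat \<Rightarrow> node set" where
  "nodes k N = {(i,j). 1 \<le> i \<and> i \<le> k \<and> 1 \<le> j \<and> j \<le> N}"

definition gbasis :: "nat \<Rightarrow> nat \<Rightarrow> (node \<Rightarrow> nat) \<Rightarrow> gidx set" where
  "gbasis k N d = {b. (\<forall>v\<in>nodes k N. b v < d v) \<and> (\<forall>v. v \<notin> nodes k N \<longrightarrow> b v = 0)}"

(* computational basis of k qubits, qubit r (1<=r<=k) has value x r \<in> {0,1} *)
definition bitvecs :: "nat \<Rightarrow> bv set" where
  "bitvecs k = {x. (\<forall>i. 1 \<le> i \<and> i \<le> k \<longrightarrow> x i < 2) \<and> (\<forall>i. \<not>(1 \<le> i \<and> i \<le> k) \<longrightarrow> x i = 0)}"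

(* the Kraus operator A (a (dd x d v)-matrix, entries A row col) acting on node v,
   identity elsewhere; applied as rho |-> L rho L^dagger *)
definition lift_local :: "node \<Rightarrow> (nat \<Rightarrow> nat \<Rightarrow> complex) \<Rightarrow> gidx \<Rightarrow> gidx \<Rightarrow> complex" where
  "lift_local v A b' b = A (b' v) (b v) * (if (\<forall>u. u \<noteq> v \<longrightarrow> b' u = b u) then 1 else 0)"

definition apply_local :: "nat \<Rightarrow> nat \<Rightarrow> (node \<Rightarrow> nat) \<Rightarrow> node \<Rightarrow> nat
    \<Rightarrow> (nat \<Rightarrow> nat \<Rightarrow> complex) \<Rightarrow> gdens \<Rightarrow> gdens" where
  "apply_local k N d v d' A \<rho> = (\<lambda>b' c'.
     if b' \<in> gbasis k N (d(v := d')) \<and> c' \<in> gbasis k N (d(v := d')) then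
       (\<Sum>b\<in>gbasis k N d. \<Sum>c\<in>gbasis k N d.
          lift_local v A b' b * \<rho> b c * cnj (lift_local v A c' c))
     else 0)"

(* ---------- final output: output qubit O_i is the lowest-order qubit of the
   system at output node v_{i,N}; everything else is traced out ---------- *)

definition out_bits :: "nat \<Rightarrow> nat \<Rightarrow> gidx \<Rightarrow> bv" where
  "out_bits k N b = (\<lambda>i. if 1 \<le> i \<and> i \<le> k then b (i,N) mod 2 else 0)"

definition rest_idx :: "nat \<Rightarrow> nat \<Rightarrow> gidx \<Rightarrow> gidx" where
  "rest_idx k N b = (\<lambda>v. if (\<exists>i. 1 \<le> i \<and> i \<le> k \<and> v = (i,N)) then b v div 2 else b v)"

definition final_trace :: "nat \<Rightarrow> nat \<Rightarrow> (node \<Rightarrow> nat) \<Rightarrow> gdens \<Rightarrow> odens" where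
  "final_trace k N d \<rho> = (\<lambda>y y'.
     \<Sum>b\<in>gbasis k N d. \<Sum>c\<in>gbasis k N d.
        (if out_bits k N b = y \<and> out_bits k N c = y' \<and> rest_idx k N b = rest_idx k N c
         then \<rho> b c else 0))"

(* ---------- LOCC protocols (finitely many rounds) ----------
   locc_out k N d \<Phi>: starting from local dimensions d, some finite-round LOCC
   protocol realizes the map \<Phi> from global density operators to density
   operators of the k output qubits.  In each round one node v applies a local
   instrument {A x}_{x\<in>X} (Kraus operators C^(d v) -> C^(dd x), which covers
   adjoining ancillas, unitaries, measurements, discarding); the outcome x is
   broadcast and the rest of the protocol may depend on it. *)

inductive locc_out :: "nat \<Rightarrow> nat \<Rightarrow> (node \<Rightarrow> nat) \<Rightarrow> (gdens \<Rightarrow> odens) \<Rightarrow> bool"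
  for k N where
  finish: "(\<forall>i. 1 \<le> i \<and> i \<le> k \<longrightarrow> even (d (i,N))) \<Longrightarrow> locc_out k N d (final_trace k N d)"
| step: "v \<in> nodes k N \<Longrightarrow> finite (X :: nat set) \<Longrightarrow>
    (\<forall>a < d v. \<forall>a' < d v. (\<Sum>x\<in>X. \<Sum>r<dd x. cnj (A x r a) * A x r a') = (if a = a' then 1 else 0)) \<Longrightarrow>
    (\<forall>x\<in>X. locc_out k N (d(v := dd x)) (\<Phi>s x)) \<Longrightarrow>
    locc_out k N d (\<lambda>\<rho> y y'. \<Sum>x\<in>X. \<Phi>s x (apply_local k N d v (dd x) (A x) \<rho>) y y')"

(* ports of a node: 0 = input qubit, 1 = up edge, 2 = down edge, 3 = left edge, 4 = right edge *)
definition port_used :: "nat \<Rightarrow> nat \<Rightarrow> node \<Rightarrow> nat \<Rightarrow> bool" where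
  "port_used k N v p = (let i = fst v; j = snd v in
     (p = 0 \<and> j = 1) \<or> (p = 1 \<and> i > 1) \<or> (p = 2 \<and> i < k) \<or> (p = 3 \<and> j > 1) \<or> (p = 4 \<and> j < N))"

definition nports :: "nat \<Rightarrow> nat \<Rightarrow> node \<Rightarrow> nat" where
  "nports k N v = length (filter (port_used k N v) [0..<5])"

definition npos :: "nat \<Rightarrow> nat \<Rightarrow> node \<Rightarrow> nat \<Rightarrow> nat" where
  "npos k N v p = length (filter (port_used k N v) [0..<p])"

(* value of the qubit sitting at port p of node v in local basis index n *)
definition pbit :: "nat \<Rightarrow> nat \<Rightarrow> node \<Rightarrow> nat \<Rightarrow> nat \<Rightarrow> nat" where
  "pbit k N v p n = (n div 2 ^ npos k N v p) mod 2"

definition d0 :: "nat \<Rightarrow> nat \<Rightarrow> node \<Rightarrow> nat" where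
  "d0 k N v = 2 ^ nports k N v"

definition nedges :: "nat \<Rightarrow> nat \<Rightarrow> nat" where
  "nedges k N = (k - 1) * N + k * (N - 1)"

definition init_amp :: "nat \<Rightarrow> nat \<Rightarrow> (bv \<Rightarrow> complex) \<Rightarrow> gidx \<Rightarrow> complex" where
  "init_amp k N \<psi> b =
     (if b \<in> gbasis k N (d0 k N) then
        \<psi> (\<lambda>i. if 1 \<le> i \<and> i \<le> k then pbit k N (i,1) 0 (b (i,1)) else 0)
        * (if (\<forall>i j. 1 \<le> i \<and> i < k \<and> 1 \<le> j \<and> j \<le> N \<longrightarrow>
                  pbit k N (i,j) 2 (b (i,j)) = pbit k N (i+1,j) 1 (b (i+1,j)))
            \<and> (\<forall>i j. 1 \<le> i \<and> i \<le> k \<and> 1 \<le> j \<and> j < N \<longrightarrow>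
                  pbit k N (i,j) 4 (b (i,j)) = pbit k N (i,j+1) 3 (b (i,j+1)))
           then 1 else 0)
        * complex_of_real ((1 / sqrt 2) ^ nedges k N)
      else 0)"

definition init_dens :: "nat \<Rightarrow> nat \<Rightarrow> (bv \<Rightarrow> complex) \<Rightarrow> gdens" where
  "init_dens k N \<psi> = (\<lambda>b c. init_amp k N \<psi> b * cnj (init_amp k N \<psi> c))"

definition apply_U :: "nat \<Rightarrow> (bv \<Rightarrow> bv \<Rightarrow> complex) \<Rightarrow> (bv \<Rightarrow> complex) \<Rightarrow> bv \<Rightarrow> complex" where
  "apply_U k U \<psi> y = (\<Sum>x\<in>bitvecs k. U y x * \<psi> x)"

definition unitary_bv :: "nat \<Rightarrow> (bv \<Rightarrow> bv \<Rightarrow> complex) \<Rightarrow> bool" where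
  "unitary_bv k U =
    ((\<forall>x\<in>bitvecs k. \<forall>x'\<in>bitvecs k. (\<Sum>y\<in>bitvecs k. cnj (U y x) * U y x') = (if x = x' then 1 else 0))
   \<and> (\<forall>y\<in>bitvecs k. \<forall>y'\<in>bitvecs k. (\<Sum>x\<in>bitvecs k. U y x * cnj (U y' x)) = (if y = y' then 1 else 0)))"

definition bv_mult :: "nat \<Rightarrow> (bv \<Rightarrow> bv \<Rightarrow> complex) \<Rightarrow> (bv \<Rightarrow> bv \<Rightarrow> complex) \<Rightarrow> bv \<Rightarrow> bv \<Rightarrow> complex" where
  "bv_mult k A B y x = (\<Sum>z\<in>bitvecs k. A y z * B z x)"

fun mat_chain :: "nat \<Rightarrow> (nat \<Rightarrow> bv \<Rightarrow> bv \<Rightarrow> complex) \<Rightarrow> nat \<Rightarrow> bv \<Rightarrow> bv \<Rightarrow> complex" where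
  "mat_chain k V 0 = (\<lambda>y x. if y = x then 1 else 0)"
| "mat_chain k V (Suc n) = bv_mult k (mat_chain k V n) (V (Suc n))"

(* V_i = sum_{a_1..a_{k-1}} E1^{(a_1)} \<otimes> Emid_2^{(a_1,a_2)} \<otimes> ... \<otimes> Emid_{k-1}^{(a_{k-2},a_{k-1})} \<otimes> Ek^{(a_{k-1})};
   E1 i m row col, Emid r i m n row col, Ek i m row col are entries of 2x2 matrices *)
definition cluster_factor :: "nat \<Rightarrow> (nat \<Rightarrow> nat \<Rightarrow> nat \<Rightarrow> nat \<Rightarrow> complex)
    \<Rightarrow> (nat \<Rightarrow> nat \<Rightarrow> nat \<Rightarrow> nat \<Rightarrow> nat \<Rightarrow> nat \<Rightarrow> complex)
    \<Rightarrow> (nat \<Rightarrow> nat \<Rightarrow> nat \<Rightarrow> nat \<Rightarrow> complex) \<Rightarrow> nat \<Rightarrow> bv \<Rightarrow> bv \<Rightarrow> complex" where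
  "cluster_factor k E1 Emid Ek i = (\<lambda>y x.
     \<Sum>a\<in>bitvecs (k - 1).
        E1 i (a 1) (y 1) (x 1)
      * (\<Prod>r\<in>{2..k-1}. Emid r i (a (r - 1)) (a r) (y r) (x r))
      * Ek i (a (k - 1)) (y k) (x k))"

definition det_implementable :: "nat \<Rightarrow> nat \<Rightarrow> (bv \<Rightarrow> bv \<Rightarrow> complex) \<Rightarrow> bool" where
  "det_implementable k N U =
    (\<exists>\<Phi>. locc_out k N (d0 k N) \<Phi> \<and>
       (\<forall>\<psi>. (\<Sum>x\<in>bitvecs k. (cmod (\<psi> x))\<^sup>2) = 1 \<longrightarrow>
          (\<forall>y\<in>bitvecs k. \<forall>y'\<in>bitvecs k.
             \<Phi> (init_dens k N \<psi>) y y' = apply_U k U \<psi> y * cnj (apply_U k U \<psi> y'))))"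

end

theory Submission
  imports Defs "HOL-Library.FuncSet"
begin

text \<open>
  An LOCC map is a sum of branches whose Kraus operators are products of operators on single nodes. Feed the
  network with vertical EPR pairs and with coefficient matrices \<open>G\<^sub>j\<close> on the horizontal bonds: a branch then acts
  as \<open>M\<^sub>N G\<^sub>N\<^sub>-\<^sub>1 M\<^sub>N\<^sub>-\<^sub>1 \<dots> G\<^sub>1 M\<^sub>1\<close>, where the column matrix \<open>M\<^sub>j\<close> has the required tensor form (the vertical bonds
  give the summation indices). With all \<open>G\<^sub>j = 1\<close>, determinism forces
  \<open>M\<^sub>N \<dots> M\<^sub>1 = c U\<close> in each branch. Replacing one \<open>G\<^sub>s\<close> by the matrix units and summing, trace preservation
  gives \<open>\<Sum> \<parallel>W\<parallel>\<^sup>2 \<parallel>L\<parallel>\<^sup>2 = D\<^sup>2 \<Sum> \<bar>c\<bar>\<^sup>2\<close> over the branches, with \<open>W L = c U\<close> the splitting of the column product at the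
  cut \<open>s\<close>, \<open>D = 2\<^sup>k\<close> and Hilbert--Schmidt norms. Since \<open>\<parallel>W\<parallel> \<parallel>L\<parallel> \<ge> \<bar>c\<bar> D\<close> by Cauchy--Schwarz, equality holds in every branch; if \<open>c \<noteq> 0\<close>,
  each prefix \<open>L\<close> is a multiple of a unitary, and hence so is each \<open>M\<^sub>j\<close>. Finally \<open>V\<^sub>i\<close> is a rescaled \<open>M\<^sub>N\<^sub>+\<^sub>1\<^sub>-\<^sub>i\<close>.
\<close>

section \<open>Product form of LOCC maps\<close>

lemma finite_nodes [simp]: "finite (nodes k N)"
  and nodes_eq: "nodes k N = {1..k} \<times> {1..N}"
proof -
  show "nodes k N = {1..k} \<times> {1..N}" by (auto simp: nodes_def)
  then show "finite (nodes k N)" by simp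
qed

lemma finite_gbasis [simp]: "finite (gbasis k N d)"
proof (rule finite_subset)
  show "finite {b. \<forall>v. (v \<in> nodes k N \<longrightarrow> b v \<in> (\<Union>v\<in>nodes k N. {..<d v})) \<and> (v \<notin> nodes k N \<longrightarrow> b v = 0)}"
    by (rule finite_set_of_finite_funs) auto
qed (auto simp: gbasis_def)

lemma finite_bitvecs [simp]: "finite (bitvecs k)"
proof (rule finite_subset)
  show "finite {x. \<forall>i. (i \<in> {1..k} \<longrightarrow> x i \<in> {..<2::nat}) \<and> (i \<notin> {1..k} \<longrightarrow> x i = 0)}"
    by (rule finite_set_of_finite_funs) auto
qed (auto simp: bitvecs_def)

lemma zero_in_bitvecs: "(\<lambda>_. 0) \<in> bitvecs k"
  by (simp add: bitvecs_def)

lemma card_bitvecs_pos: "card (bitvecs k) > 0"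
  using zero_in_bitvecs by (auto simp: card_gt_0_iff)

lemma out_bits_in_bitvecs: "out_bits k N b \<in> bitvecs k"
  by (auto simp: out_bits_def bitvecs_def)

text \<open>Each entry in the output column is recovered from its remainder and quotient by 2. Hence
  the trace of the partial trace only sees the diagonal of the global matrix.\<close>

lemma out_rest_inject:
  assumes "out_bits k N b = out_bits k N c" "rest_idx k N b = rest_idx k N c"
  shows "b = c"
proof
  fix v
  show "b v = c v"
  proof (cases "\<exists>i. 1 \<le> i \<and> i \<le> k \<and> v = (i, N)")
    case True
    then obtain i where i: "1 \<le> i" "i \<le> k" "v = (i, N)" by blast
    have "b v mod 2 = c v mod 2" using fun_cong[OF assms(1), of i] i by (simp add: out_bits_def)
    moreover have "b v div 2 = c v div 2"
      using fun_cong[OF assms(2), of v] True by (simp add: rest_idx_def)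
    ultimately show ?thesis by (metis div_mult_mod_eq)
  next
    case False
    then show ?thesis using fun_cong[OF assms(2), of v] by (simp only: rest_idx_def if_False)
  qed
qed

lemma sum_lift_local:
  assumes "v \<in> nodes k N" "b \<in> gbasis k N d"
  shows "(\<Sum>b'\<in>gbasis k N (d(v := e)). F b' * lift_local v A b' b) = (\<Sum>n<e. F (b(v := n)) * A n (b v))"
proof -
  have "(\<Sum>b'\<in>gbasis k N (d(v := e)). F b' * lift_local v A b' b)
      = (\<Sum>b'\<in>(\<lambda>n. b(v := n)) ` {..<e}. F b' * lift_local v A b' b)"
  proof (rule sum.mono_neutral_right)
    show "(\<lambda>n. b(v := n)) ` {..<e} \<subseteq> gbasis k N (d(v := e))"
      using assms by (auto simp: gbasis_def)
    show "\<forall>b'\<in>gbasis k N (d(v := e)) - (\<lambda>n. b(v := n)) ` {..<e}. F b' * lift_local v A b' b = 0"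
    proof
      fix b' assume b': "b' \<in> gbasis k N (d(v := e)) - (\<lambda>n. b(v := n)) ` {..<e}"
      then have "b' v < e" using assms by (force simp: gbasis_def)
      then have "b' \<noteq> b(v := b' v)" using b' by blast
      then obtain u where "u \<noteq> v" "b' u \<noteq> b u" by (metis ext fun_upd_apply)
      then have "\<not> (\<forall>u. u \<noteq> v \<longrightarrow> b' u = b u)" by blast
      then have "lift_local v A b' b = 0" by (simp only: lift_local_def if_False mult_zero_right)
      then show "F b' * lift_local v A b' b = 0" by simp
    qed
  qed simp
  also have "\<dots> = (\<Sum>n<e. F (b(v := n)) * lift_local v A (b(v := n)) b)"
    by (rule sum.reindex_cong[of "\<lambda>n. b(v := n)"]) (auto intro!: inj_onI dest: fun_upd_eqD)
  also have "\<dots> = (\<Sum>n<e. F (b(v := n)) * A n (b v))"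
    by (simp add: lift_local_def)
  finally show ?thesis .
qed

text \<open>The untouched nodes contribute only a delta factor, so completeness of the local
  instrument becomes completeness of the lifted Kraus operators on the whole network.\<close>

lemma sum_lift_local_complete:
  assumes v: "v \<in> nodes k N" and b: "b \<in> gbasis k N d" and c: "c \<in> gbasis k N d"
    and compl: "\<forall>a < d v. \<forall>a' < d v. (\<Sum>x\<in>X. \<Sum>r<dd x. cnj (A x r a) * A x r a') = (if a = a' then 1 else 0)"
  shows "(\<Sum>x\<in>X. \<Sum>b'\<in>gbasis k N (d(v := dd x)). cnj (lift_local v (A x) b' c) * lift_local v (A x) b' b)
    = (if b = c then 1 else 0)"
proof -
  let ?D = "if \<forall>u. u \<noteq> v \<longrightarrow> b u = c u then 1 else (0::complex)"
  have "(\<Sum>x\<in>X. \<Sum>b'\<in>gbasis k N (d(v := dd x)). cnj (lift_local v (A x) b' c) * lift_local v (A x) b' b)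
     = (\<Sum>x\<in>X. \<Sum>n<dd x. ?D * (cnj (A x n (c v)) * A x n (b v)))"
    unfolding sum_lift_local[OF v b] by (simp add: lift_local_def)
  also have "\<dots> = ?D * (\<Sum>x\<in>X. \<Sum>n<dd x. cnj (A x n (c v)) * A x n (b v))"
    by (simp only: sum_distrib_left)
  also have "(\<Sum>x\<in>X. \<Sum>n<dd x. cnj (A x n (c v)) * A x n (b v)) = (if c v = b v then 1 else 0)"
    using compl b c v by (auto simp: gbasis_def)
  also have "?D * (if c v = b v then 1 else 0) = (if b = c then 1 else 0)"
    by (auto intro!: ext) metis
  finally show ?thesis .
qed

text \<open>Each round preserves the trace by completeness of its instrument, and so does the final
  partial trace. Since \<open>\<rho>\<close> is an arbitrary matrix, this applies later to
  unnormalised inputs other than the resource state.\<close>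

lemma locc_out_trace:
  assumes "locc_out k N d \<Phi>"
  shows "(\<Sum>y\<in>bitvecs k. \<Phi> \<rho> y y) = (\<Sum>b\<in>gbasis k N d. \<rho> b b)"
  using assms
proof (induction arbitrary: \<rho>)
  case (finish d)
  have "(\<Sum>y\<in>bitvecs k. final_trace k N d \<rho> y y)
    = (\<Sum>b\<in>gbasis k N d. \<Sum>c\<in>gbasis k N d. \<Sum>y\<in>bitvecs k.
        if out_bits k N b = y then if b = c then \<rho> b c else 0 else 0)"
    unfolding final_trace_def
    by (subst sum.swap, rule sum.cong, rule refl, subst sum.swap)
       (auto intro!: sum.cong dest: out_rest_inject)
  also have "\<dots> = (\<Sum>b\<in>gbasis k N d. \<Sum>c\<in>gbasis k N d. if b = c then \<rho> b c else 0)"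
    by (intro sum.cong refl) (simp add: out_bits_in_bitvecs)
  finally show ?case by simp
next
  case (step v X d A dd \<Phi>s)
  let ?G = "gbasis k N d" and ?G' = "\<lambda>x. gbasis k N (d(v := dd x))"
  let ?l = "\<lambda>x. lift_local v (A x)"
  have "(\<Sum>y\<in>bitvecs k. \<Sum>x\<in>X. \<Phi>s x (apply_local k N d v (dd x) (A x) \<rho>) y y)
    = (\<Sum>x\<in>X. \<Sum>b'\<in>?G' x. apply_local k N d v (dd x) (A x) \<rho> b' b')"
    by (subst sum.swap, rule sum.cong[OF refl]) (use step.IH in blast)
  also have "\<dots> = (\<Sum>x\<in>X. \<Sum>b'\<in>?G' x. \<Sum>b\<in>?G. \<Sum>c\<in>?G. ?l x b' b * \<rho> b c * cnj (?l x b' c))"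
    by (intro sum.cong refl) (simp add: apply_local_def)
  also have "\<dots> = (\<Sum>x\<in>X. \<Sum>b\<in>?G. \<Sum>c\<in>?G. \<Sum>b'\<in>?G' x. ?l x b' b * \<rho> b c * cnj (?l x b' c))"
    by (subst sum.swap, rule sum.cong[OF refl], subst sum.swap, rule refl)
  also have "\<dots> = (\<Sum>b\<in>?G. \<Sum>c\<in>?G. \<Sum>x\<in>X. \<Sum>b'\<in>?G' x. ?l x b' b * \<rho> b c * cnj (?l x b' c))"
    by (subst sum.swap, rule sum.cong[OF refl], subst sum.swap, rule refl)
  also have "\<dots> = (\<Sum>b\<in>?G. \<Sum>c\<in>?G. \<rho> b c * (\<Sum>x\<in>X. \<Sum>b'\<in>?G' x. cnj (?l x b' c) * ?l x b' b))"
    by (simp only: sum_distrib_left mult.assoc mult.commute mult.left_commute)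
  also have "\<dots> = (\<Sum>b\<in>?G. \<Sum>c\<in>?G. if b = c then \<rho> b c else 0)"
    using step.hyps by (intro sum.cong refl) (simp add: sum_lift_local_complete)
  finally show ?case by simp
qed

text \<open>Entry of a tensor product of node operators. A node of the last column maps to its
  output qubit, with row index the bit of \<open>y\<close>; every other node carries a functional,
  whose single row is labelled 0.\<close>

definition prod_kraus :: "nat \<Rightarrow> nat \<Rightarrow> (node \<Rightarrow> nat \<Rightarrow> nat \<Rightarrow> complex) \<Rightarrow> bv \<Rightarrow> gidx \<Rightarrow> complex" where
  "prod_kraus k N B y b = (\<Prod>v\<in>nodes k N. B v (if snd v = N then y (fst v) else 0) (b v))"

text \<open>Composing with a local Kraus operator is a matrix product in the factor at
  \<open>v\<close> alone, so the tensor product form survives.\<close>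

lemma prod_kraus_update:
  assumes "v \<in> nodes k N"
  shows "prod_kraus k N (B(v := \<lambda>y n. \<Sum>n'<e. B v y n' * A n' n)) y b
    = (\<Sum>n'<e. prod_kraus k N B y (b(v := n')) * A n' (b v))"
proof -
  let ?o = "\<lambda>v. if snd v = N then y (fst v) else 0"
  let ?P = "\<Prod>u\<in>nodes k N - {v}. B u (?o u) (b u)"
  have 1: "prod_kraus k N B y (b(v := n)) = B v (?o v) n * ?P" for n
    unfolding prod_kraus_def by (subst prod.remove[OF _ assms]) (auto intro!: prod.cong)
  have "prod_kraus k N (B(v := \<lambda>y n. \<Sum>n'<e. B v y n' * A n' n)) y b
    = (\<Sum>n'<e. B v (?o v) n' * A n' (b v)) * ?P"
    unfolding prod_kraus_def by (subst prod.remove[OF _ assms]) (auto intro!: prod.cong)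
  also have "\<dots> = (\<Sum>n'<e. B v (?o v) n' * ?P * A n' (b v))"
    by (simp add: sum_distrib_right mult.assoc mult.commute mult.left_commute)
  finally show ?thesis unfolding 1 .
qed

text \<open>These 0-1 operators read off the value \<open>r\<close> of the discarded systems and
  keep the output bits. They are the Kraus operators of the partial trace, one for each
  \<open>r\<close>.\<close>

lemma prod_kraus_rest:
  "prod_kraus k N (\<lambda>v y n. if (if snd v = N then n mod 2 = y \<and> n div 2 = r v else n = r v) then 1 else 0) y b
    = (if \<forall>v\<in>nodes k N. if snd v = N then b v mod 2 = y (fst v) \<and> b v div 2 = r v else b v = r v then 1 else 0)"
proof -
  have "(\<Prod>v\<in>S. if P v then 1 else (0::complex)) = (if \<forall>v\<in>S. P v then 1 else 0)" if "finite S" for S :: "node set" and P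
    using that by induction auto
  from this[OF finite_nodes[of k N]] show ?thesis
    unfolding prod_kraus_def by (auto intro!: prod.cong)
qed

text \<open>Branches form a list, so equal operators from different outcomes are counted separately.
  One list serves all \<open>\<rho>\<close>, so the same branches can be probed with any
  input.\<close>

definition product_form :: "nat \<Rightarrow> nat \<Rightarrow> (node \<Rightarrow> nat) \<Rightarrow> (gdens \<Rightarrow> odens) \<Rightarrow> (node \<Rightarrow> nat \<Rightarrow> nat \<Rightarrow> complex) list \<Rightarrow> bool" where
  "product_form k N d \<Phi> Bs \<longleftrightarrow> (\<forall>\<rho>. \<forall>y\<in>bitvecs k. \<forall>y'\<in>bitvecs k. \<Phi> \<rho> y y' =
     (\<Sum>B\<leftarrow>Bs. \<Sum>b\<in>gbasis k N d. \<Sum>c\<in>gbasis k N d.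
        prod_kraus k N B y b * \<rho> b c * cnj (prod_kraus k N B y' c)))"

lemma sum_list_sum_swap:
  "(\<Sum>x\<leftarrow>xs. \<Sum>b\<in>S. f x b) = (\<Sum>b\<in>S. \<Sum>x\<leftarrow>xs. f x b)" for f :: "_ \<Rightarrow> _ \<Rightarrow> 'a::comm_monoid_add"
  by (induction xs) (auto simp: sum.distrib)

lemma rest_idx_outside:
  assumes "b \<in> gbasis k N d" "v \<notin> nodes k N"
  shows "rest_idx k N b v = 0"
  using assms unfolding rest_idx_def gbasis_def by (metis (mono_tags, lifting) div_0 mem_Collect_eq)

lemma product_form_final_trace:
  assumes "N \<ge> 1"
  shows "\<exists>Bs. product_form k N d (final_trace k N d) Bs"
proof -
  let ?G = "gbasis k N d"
  let ?B = "\<lambda>r v y n. if (if snd v = N then n mod 2 = y \<and> n div 2 = r v else n = (r v :: nat)) then 1 else (0::complex)"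
  have K: "prod_kraus k N (?B r) y b = (if out_bits k N b = y \<and> rest_idx k N b = r then 1 else 0)"
    if b: "b \<in> ?G" and y: "y \<in> bitvecs k" and r: "r \<in> rest_idx k N ` ?G" for r y b
  proof -
    have "(\<forall>v\<in>nodes k N. if snd v = N then b v mod 2 = y (fst v) \<and> b v div 2 = r v else b v = r v)
       \<longleftrightarrow> out_bits k N b = y \<and> rest_idx k N b = r" (is "?l = ?r")
    proof
      assume ?r
      then show ?l by (auto simp: nodes_def out_bits_def rest_idx_def)
    next
      assume l: ?l
      have "out_bits k N b i = y i" for i
      proof (cases "1 \<le> i \<and> i \<le> k")
        case True
        then show ?thesis using \<open>N \<ge> 1\<close> bspec[OF l, of "(i,N)"] by (auto simp: nodes_def out_bits_def)
      next
        case False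
        then show ?thesis using y by (auto simp: out_bits_def bitvecs_def)
      qed
      moreover have "rest_idx k N b v = r v" for v
      proof (cases "v \<in> nodes k N")
        case True
        then show ?thesis using bspec[OF l True] by (cases v) (auto simp: rest_idx_def nodes_def split: if_splits)
      next
        case False
        then show ?thesis using r b by (auto simp: rest_idx_outside)
      qed
      ultimately show ?r by blast
    qed
    then show ?thesis unfolding prod_kraus_rest by simp
  qed
  obtain rs where rs: "set rs = rest_idx k N ` ?G" "distinct rs"
    using finite_distinct_list[of "rest_idx k N ` ?G"] by auto
  have "product_form k N d (final_trace k N d) (map ?B rs)"
    unfolding product_form_def
  proof (intro allI ballI)
    fix \<rho> y y' assume y: "y \<in> bitvecs k" "y' \<in> bitvecs k"
    have "(\<Sum>B\<leftarrow>map ?B rs. \<Sum>b\<in>?G. \<Sum>c\<in>?G. prod_kraus k N B y b * \<rho> b c * cnj (prod_kraus k N B y' c))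
      = (\<Sum>r\<in>rest_idx k N ` ?G. \<Sum>b\<in>?G. \<Sum>c\<in>?G. prod_kraus k N (?B r) y b * \<rho> b c * cnj (prod_kraus k N (?B r) y' c))"
      by (simp add: o_def sum_list_distinct_conv_sum_set rs)
    also have "\<dots> = (\<Sum>r\<in>rest_idx k N ` ?G. \<Sum>b\<in>?G. \<Sum>c\<in>?G. if rest_idx k N b = r then
        if out_bits k N b = y \<and> out_bits k N c = y' \<and> rest_idx k N b = rest_idx k N c then \<rho> b c else 0 else 0)"
      by (intro sum.cong refl) (use y in \<open>auto simp: K\<close>)
    also have "\<dots> = (\<Sum>b\<in>?G. \<Sum>c\<in>?G. \<Sum>r\<in>rest_idx k N ` ?G. if rest_idx k N b = r then
        if out_bits k N b = y \<and> out_bits k N c = y' \<and> rest_idx k N b = rest_idx k N c then \<rho> b c else 0 else 0)"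
      by (subst sum.swap, rule sum.cong[OF refl], subst sum.swap, rule refl)
    also have "\<dots> = final_trace k N d \<rho> y y'"
      unfolding final_trace_def by (intro sum.cong refl) simp
    finally show "final_trace k N d \<rho> y y' = (\<Sum>B\<leftarrow>map ?B rs. \<Sum>b\<in>?G. \<Sum>c\<in>?G. prod_kraus k N B y b * \<rho> b c * cnj (prod_kraus k N B y' c))"
      by simp
  qed
  then show ?thesis ..
qed

lemma product_form_apply_local:
  assumes v: "v \<in> nodes k N" and Bs: "product_form k N (d(v := e)) \<Phi> Bs"
  shows "product_form k N d (\<lambda>\<rho>. \<Phi> (apply_local k N d v e A \<rho>))
    (map (\<lambda>B. B(v := \<lambda>y n. \<Sum>n'<e. B v y n' * A n' n)) Bs)"
  unfolding product_form_def
proof (intro allI ballI)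
  fix \<rho> y y' assume y: "y \<in> bitvecs k" "y' \<in> bitvecs k"
  let ?G = "gbasis k N d" and ?G' = "gbasis k N (d(v := e))"
  let ?l = "lift_local v A" and ?K = "prod_kraus k N" and ?u = "\<lambda>B. B(v := \<lambda>y n. \<Sum>n'<e. B v y n' * A n' n)"
  have K: "?K (?u B) y b = (\<Sum>b'\<in>?G'. ?K B y b' * ?l b' b)" if "b \<in> ?G" for B y b
    using that v by (simp add: sum_lift_local prod_kraus_update)
  have "(\<Sum>b'\<in>?G'. \<Sum>c'\<in>?G'. ?K B y b' * apply_local k N d v e A \<rho> b' c' * cnj (?K B y' c'))
    = (\<Sum>b\<in>?G. \<Sum>c\<in>?G. ?K (?u B) y b * \<rho> b c * cnj (?K (?u B) y' c))" for B
  proof -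
    have "(\<Sum>b'\<in>?G'. \<Sum>c'\<in>?G'. ?K B y b' * apply_local k N d v e A \<rho> b' c' * cnj (?K B y' c'))
      = (\<Sum>b'\<in>?G'. \<Sum>c'\<in>?G'. \<Sum>b\<in>?G. \<Sum>c\<in>?G. (?K B y b' * ?l b' b) * \<rho> b c * cnj (?K B y' c' * ?l c' c))"
      by (intro sum.cong refl) (simp add: apply_local_def sum_distrib_left sum_distrib_right mult_ac)
    also have "\<dots> = (\<Sum>b'\<in>?G'. \<Sum>b\<in>?G. \<Sum>c\<in>?G. \<Sum>c'\<in>?G'. (?K B y b' * ?l b' b) * \<rho> b c * cnj (?K B y' c' * ?l c' c))"
      by (rule sum.cong[OF refl], subst sum.swap, rule sum.cong[OF refl], subst sum.swap, rule refl)
    also have "\<dots> = (\<Sum>b\<in>?G. \<Sum>c\<in>?G. \<Sum>b'\<in>?G'. \<Sum>c'\<in>?G'. (?K B y b' * ?l b' b) * \<rho> b c * cnj (?K B y' c' * ?l c' c))"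
      by (subst sum.swap, rule sum.cong[OF refl], subst sum.swap, rule refl)
    also have "\<dots> = (\<Sum>b\<in>?G. \<Sum>c\<in>?G. (\<Sum>b'\<in>?G'. ?K B y b' * ?l b' b) * \<rho> b c * cnj (\<Sum>c'\<in>?G'. ?K B y' c' * ?l c' c))"
      by (rule sum.cong[OF refl], rule sum.cong[OF refl], subst sum.swap) (simp only: sum_distrib_left sum_distrib_right cnj_sum)
    finally show ?thesis by (simp add: K)
  qed
  then show "\<Phi> (apply_local k N d v e A \<rho>) y y' = (\<Sum>B\<leftarrow>map ?u Bs. \<Sum>b\<in>?G. \<Sum>c\<in>?G. ?K B y b * \<rho> b c * cnj (?K B y' c))"
    using Bs y by (simp add: product_form_def o_def)
qed

lemma product_form_add:
  assumes "product_form k N d \<Phi> Bs" "product_form k N d \<Phi>' Bs'"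
  shows "product_form k N d (\<lambda>\<rho> y y'. \<Phi> \<rho> y y' + \<Phi>' \<rho> y y') (Bs @ Bs')"
  using assms by (simp add: product_form_def)

lemma product_form_sum:
  assumes "finite X" "\<And>x. x \<in> X \<Longrightarrow> \<exists>Bs. product_form k N d (\<Phi>s x) Bs"
  shows "\<exists>Bs. product_form k N d (\<lambda>\<rho> y y'. \<Sum>x\<in>X. \<Phi>s x \<rho> y y') Bs"
  using assms
proof (induction X)
  case empty
  have "product_form k N d (\<lambda>\<rho> y y'. \<Sum>x\<in>{}. \<Phi>s x \<rho> y y') []" by (simp add: product_form_def)
  then show ?case ..
next
  case (insert x X)
  obtain Bs where 1: "product_form k N d (\<Phi>s x) Bs" using insert.prems by blast
  obtain Bs' where 2: "product_form k N d (\<lambda>\<rho> y y'. \<Sum>x\<in>X. \<Phi>s x \<rho> y y') Bs'"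
    using insert by blast
  from product_form_add[OF 1 2] show ?case using insert.hyps by auto
qed

text \<open>Induction from the end of the protocol: each round merges its local operator into every
  branch of each continuation, and the branches of different outcomes are concatenated.\<close>

lemma locc_out_product_form:
  assumes "locc_out k N d \<Phi>" "N \<ge> 1"
  shows "\<exists>Bs. product_form k N d \<Phi> Bs"
  using assms(1)
proof induction
  case (finish d)
  show ?case using assms(2) by (rule product_form_final_trace)
next
  case (step v X d A dd \<Phi>s)
  show ?case
    using step.IH step.hyps product_form_apply_local by (intro product_form_sum) blast+
qed

section \<open>Matrices indexed by bit vectors\<close>

lemma bv_mult_assoc: "bv_mult k A (bv_mult k B C) = bv_mult k (bv_mult k A B) C"
  by (intro ext) (simp add: bv_mult_def sum_distrib_left sum_distrib_right mult.assoc, rule sum.swap)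

definition adj :: "(bv \<Rightarrow> bv \<Rightarrow> complex) \<Rightarrow> bv \<Rightarrow> bv \<Rightarrow> complex" where
  "adj A = (\<lambda>y x. cnj (A x y))"

definition bvI :: "bv \<Rightarrow> bv \<Rightarrow> complex" where
  "bvI = (\<lambda>y x. if y = x then 1 else 0)"

text \<open>Matrices are total functions, but only entries indexed by \<open>bitvecs k\<close> carry
  meaning; equality is therefore required only there.\<close>

definition eq_bv :: "nat \<Rightarrow> (bv \<Rightarrow> bv \<Rightarrow> complex) \<Rightarrow> (bv \<Rightarrow> bv \<Rightarrow> complex) \<Rightarrow> bool" where
  "eq_bv k A B \<longleftrightarrow> (\<forall>y\<in>bitvecs k. \<forall>x\<in>bitvecs k. A y x = B y x)"

definition hs2 :: "nat \<Rightarrow> (bv \<Rightarrow> bv \<Rightarrow> complex) \<Rightarrow> real" where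
  "hs2 k A = (\<Sum>y\<in>bitvecs k. \<Sum>x\<in>bitvecs k. (cmod (A y x))\<^sup>2)"


lemma eq_bv_refl [simp]: "eq_bv k A A"
  and eq_bv_sym: "eq_bv k A B \<Longrightarrow> eq_bv k B A"
  and eq_bv_trans [trans]: "eq_bv k A B \<Longrightarrow> eq_bv k B C \<Longrightarrow> eq_bv k A C"
  by (auto simp: eq_bv_def)

lemma bv_mult_cong: "eq_bv k A A' \<Longrightarrow> eq_bv k B B' \<Longrightarrow> eq_bv k (bv_mult k A B) (bv_mult k A' B')"
  by (auto simp: eq_bv_def bv_mult_def intro!: sum.cong)

lemma bv_mult_I_right: "eq_bv k (bv_mult k A bvI) A"
proof -
  have "bv_mult k A bvI y x = (\<Sum>z\<in>bitvecs k. if z = x then A y z else 0)" for y x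
    unfolding bv_mult_def bvI_def by (rule sum.cong) auto
  then show ?thesis by (simp add: eq_bv_def)
qed

lemma bv_mult_I_left: "eq_bv k (bv_mult k bvI A) A"
proof -
  have "bv_mult k bvI A y x = (\<Sum>z\<in>bitvecs k. if y = z then A z x else 0)" for y x
    unfolding bv_mult_def bvI_def by (rule sum.cong) auto
  then show ?thesis by (simp add: eq_bv_def)
qed

lemma adj_mult: "adj (bv_mult k A B) = bv_mult k (adj B) (adj A)"
  by (intro ext) (simp add: adj_def bv_mult_def mult.commute)

lemma adj_adj [simp]: "adj (adj A) = A"
  by (simp add: adj_def)

lemma adj_cong: "eq_bv k A B \<Longrightarrow> eq_bv k (adj A) (adj B)"
  by (simp add: eq_bv_def adj_def)

lemma unitary_bv_iff:
  "unitary_bv k U \<longleftrightarrow> eq_bv k (bv_mult k (adj U) U) bvI \<and> eq_bv k (bv_mult k U (adj U)) bvI"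
  by (simp add: unitary_bv_def eq_bv_def bv_mult_def adj_def bvI_def)

lemma unitary_bv_adj: "unitary_bv k U \<Longrightarrow> unitary_bv k (adj U)"
  by (simp add: unitary_bv_iff)

lemma adj_bvI: "adj bvI = bvI"
  by (rule ext, rule ext) (simp add: adj_def bvI_def)

lemma unitary_bv_cong:
  assumes "eq_bv k U V" "unitary_bv k V"
  shows "unitary_bv k U"
proof -
  have "eq_bv k (bv_mult k (adj U) U) (bv_mult k (adj V) V)"
    using assms(1) by (intro bv_mult_cong adj_cong)
  moreover have "eq_bv k (bv_mult k U (adj U)) (bv_mult k V (adj V))"
    using assms(1) by (intro bv_mult_cong adj_cong)
  ultimately show ?thesis using assms(2) unfolding unitary_bv_iff by (meson eq_bv_trans)
qed

lemma unitary_bv_I: "unitary_bv k bvI"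
  by (simp add: unitary_bv_iff adj_bvI bv_mult_I_right)

lemma isometry_bv_mult:
  assumes A: "eq_bv k (bv_mult k (adj A) A) bvI" and B: "eq_bv k (bv_mult k (adj B) B) bvI"
  shows "eq_bv k (bv_mult k (adj (bv_mult k A B)) (bv_mult k A B)) bvI"
proof -
  have "eq_bv k (bv_mult k (bv_mult k (adj B) (bv_mult k (adj A) A)) B) (bv_mult k (bv_mult k (adj B) bvI) B)"
    by (rule bv_mult_cong[OF bv_mult_cong[OF eq_bv_refl A] eq_bv_refl])
  moreover have "eq_bv k (bv_mult k (bv_mult k (adj B) bvI) B) (bv_mult k (adj B) B)"
    by (rule bv_mult_cong[OF bv_mult_I_right eq_bv_refl])
  ultimately show ?thesis
    unfolding adj_mult bv_mult_assoc using B eq_bv_trans by blast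
qed

lemma unitary_bv_mult:
  assumes "unitary_bv k U" "unitary_bv k V"
  shows "unitary_bv k (bv_mult k U V)"
  using isometry_bv_mult[of k U V] isometry_bv_mult[of k "adj V" "adj U"] assms
  unfolding unitary_bv_iff adj_mult adj_adj by blast

lemma bv_mult_unitary_cancel:
  assumes "unitary_bv k L" "eq_bv k (bv_mult k M L) P"
  shows "eq_bv k M (bv_mult k P (adj L))"
proof -
  have LL: "eq_bv k bvI (bv_mult k L (adj L))"
    using assms(1) by (simp add: unitary_bv_iff eq_bv_sym)
  have "eq_bv k M (bv_mult k M bvI)" by (rule eq_bv_sym[OF bv_mult_I_right])
  also have "eq_bv k \<dots> (bv_mult k M (bv_mult k L (adj L)))"
    by (rule bv_mult_cong[OF eq_bv_refl LL])
  also have "\<dots> = bv_mult k (bv_mult k M L) (adj L)" by (rule bv_mult_assoc)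
  also have "eq_bv k \<dots> (bv_mult k P (adj L))" by (rule bv_mult_cong[OF assms(2) eq_bv_refl])
  finally show ?thesis .
qed

lemma unitary_bv_left_quotient:
  assumes "unitary_bv k L" "unitary_bv k P" "eq_bv k (bv_mult k M L) P"
  shows "unitary_bv k M"
  by (rule unitary_bv_cong[OF bv_mult_unitary_cancel[OF assms(1,3)] unitary_bv_mult[OF assms(2) unitary_bv_adj[OF assms(1)]]])

section \<open>Hilbert-Schmidt inner product and Cauchy-Schwarz\<close>

definition hs_inner :: "nat \<Rightarrow> (bv \<Rightarrow> bv \<Rightarrow> complex) \<Rightarrow> (bv \<Rightarrow> bv \<Rightarrow> complex) \<Rightarrow> complex" where
  "hs_inner k A B = (\<Sum>x\<in>bitvecs k. bv_mult k (adj A) B x x)"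

lemma hs_inner_eq: "hs_inner k A B = (\<Sum>y\<in>bitvecs k. \<Sum>x\<in>bitvecs k. cnj (A y x) * B y x)"
  unfolding hs_inner_def bv_mult_def adj_def by (rule sum.swap)

lemma hs2_eq: "complex_of_real (hs2 k A) = hs_inner k A A"
  unfolding hs2_def hs_inner_eq by (simp only: of_real_sum complex_norm_square mult.commute)

lemma hs2_nonneg: "hs2 k A \<ge> 0"
  unfolding hs2_def by (simp add: sum_nonneg)

lemma hs2_eq_0_iff: "hs2 k A = 0 \<longleftrightarrow> eq_bv k A (\<lambda>y x. 0)"
  unfolding hs2_def eq_bv_def by (simp add: sum_nonneg_eq_0_iff sum_nonneg)

text \<open>\<open>1 - A A\<^sup>*\<close> is a self-adjoint idempotent of trace zero.\<close>

lemma unitary_bv_if_isometry: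
  assumes "eq_bv k (bv_mult k (adj A) A) bvI"
  shows "unitary_bv k A"
proof -
  let ?P = "bv_mult k A (adj A)" and ?B = "bitvecs k"
  have adjP: "adj ?P = ?P" by (simp only: adj_mult adj_adj)
  have "eq_bv k (bv_mult k (bv_mult k A (bv_mult k (adj A) A)) (adj A)) (bv_mult k (bv_mult k A bvI) (adj A))"
    by (rule bv_mult_cong[OF bv_mult_cong[OF eq_bv_refl assms] eq_bv_refl])
  moreover have "eq_bv k (bv_mult k (bv_mult k A bvI) (adj A)) ?P"
    by (rule bv_mult_cong[OF bv_mult_I_right eq_bv_refl])
  ultimately have PP: "eq_bv k (bv_mult k ?P ?P) ?P"
    unfolding bv_mult_assoc using eq_bv_trans by blast
  have trP: "(\<Sum>x\<in>?B. ?P x x) = of_nat (card ?B)"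
  proof -
    have "(\<Sum>x\<in>?B. ?P x x) = (\<Sum>x\<in>?B. bv_mult k (adj A) A x x)"
      unfolding bv_mult_def adj_def by (subst sum.swap) (simp add: mult.commute)
    also have "\<dots> = (\<Sum>x\<in>?B. 1)"
      using assms by (intro sum.cong) (auto simp: eq_bv_def bvI_def)
    finally show ?thesis by simp
  qed
  \<comment> \<open>Write D for the dimension and P for \<open>?P\<close>. As P is self-adjoint, the
    squared norm of P - 1 equals tr(P P) + D - 2 Re tr P; idempotence gives tr(P P) = tr P = D, so
    it vanishes.\<close>
  have "complex_of_real (hs2 k (\<lambda>y x. ?P y x - bvI y x))
    = (\<Sum>y\<in>?B. \<Sum>x\<in>?B. cnj (?P y x) * ?P y x + (if y = x then 1 - ?P y x - cnj (?P y x) else 0))"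
    unfolding hs2_eq hs_inner_eq by (intro sum.cong refl) (auto simp: bvI_def algebra_simps)
  also have "\<dots> = (\<Sum>y\<in>?B. \<Sum>x\<in>?B. cnj (?P y x) * ?P y x) + (\<Sum>y\<in>?B. 1 - ?P y y - cnj (?P y y))"
    by (simp add: sum.distrib)
  also have "(\<Sum>y\<in>?B. 1 - ?P y y - cnj (?P y y)) = (\<Sum>y\<in>?B. 1) - (\<Sum>y\<in>?B. ?P y y) - (\<Sum>y\<in>?B. cnj (?P y y))"
    by (simp only: sum_subtractf)
  also have "(\<Sum>y\<in>?B. \<Sum>x\<in>?B. cnj (?P y x) * ?P y x) = (\<Sum>y\<in>?B. ?P y y)"
    using PP adjP unfolding hs_inner_eq[symmetric] hs_inner_def by (simp add: eq_bv_def)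
  also have "(\<Sum>y\<in>?B. cnj (?P y y)) = cnj (\<Sum>y\<in>?B. ?P y y)" by simp
  finally have "hs2 k (\<lambda>y x. ?P y x - bvI y x) = 0" by (simp add: trP)
  then have "eq_bv k ?P bvI" unfolding hs2_eq_0_iff by (simp add: eq_bv_def)
  then show ?thesis using assms by (simp add: unitary_bv_iff)
qed

lemma hs2_diff_scaled:
  "complex_of_real (hs2 k (\<lambda>y x. B y x - s * A y x))
    = hs_inner k B B - s * hs_inner k B A - cnj s * hs_inner k A B + cnj s * s * hs_inner k A A"
  unfolding hs2_eq hs_inner_eq by (simp add: algebra_simps sum_subtractf sum.distrib sum_distrib_left)

text \<open>Expands the residual of \<open>B\<close> after orthogonal projection onto
  \<open>A\<close>. Its nonnegativity is Cauchy-Schwarz, and its vanishing is the equality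
  case.\<close>

lemma hs_Cauchy_Schwarz:
  assumes "hs2 k A > 0"
  shows "hs2 k (\<lambda>y x. B y x - hs_inner k A B / hs2 k A * A y x) = hs2 k B - (cmod (hs_inner k A B))\<^sup>2 / hs2 k A"
proof -
  let ?t = "hs_inner k A B" and ?n = "complex_of_real (hs2 k A)"
  have BA: "hs_inner k B A = cnj ?t" by (simp add: hs_inner_eq mult.commute)
  have "complex_of_real (hs2 k (\<lambda>y x. B y x - ?t / ?n * A y x))
    = hs_inner k B B - ?t / ?n * hs_inner k B A - cnj (?t / ?n) * ?t + cnj (?t / ?n) * (?t / ?n) * hs_inner k A A"
    by (rule hs2_diff_scaled)
  also have "\<dots> = of_real (hs2 k B) - ?t * cnj ?t / ?n"
    unfolding BA hs2_eq[symmetric] using assms by (simp add: field_simps)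
  also have "\<dots> = of_real (hs2 k B - (cmod ?t)\<^sup>2 / hs2 k A)"
    by (simp only: of_real_diff of_real_divide complex_norm_square)
  finally show ?thesis by (simp only: of_real_eq_iff)
qed

text \<open>Cauchy--Schwarz for \<open>\<langle>W\<^sup>* U, L\<rangle> = c D\<close>; in case of equality \<open>L\<close> is a multiple of \<open>W\<^sup>* U\<close>.\<close>

lemma hs2_factorisation:
  assumes U: "unitary_bv k U" and WL: "eq_bv k (bv_mult k W L) (\<lambda>y x. c * U y x)"
  defines "D \<equiv> real (card (bitvecs k))"
  shows hs2_factorisation_le: "(cmod c)\<^sup>2 * D\<^sup>2 \<le> hs2 k W * hs2 k L"
    and hs2_factorisation_eq: "c \<noteq> 0 \<Longrightarrow> (cmod c)\<^sup>2 * D\<^sup>2 = hs2 k W * hs2 k L \<Longrightarrow>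
      \<exists>\<gamma>. \<gamma> \<noteq> 0 \<and> unitary_bv k (\<lambda>y x. L y x / \<gamma>)"
proof -
  let ?B = "bitvecs k"
  \<comment> \<open>With this choice \<open>adj A\<close> times \<open>L\<close> is
    \<open>adj U\<close> times \<open>W L\<close>, that is, \<open>c\<close> times the identity. So
    the inner product of \<open>A\<close> and \<open>L\<close> is \<open>c * D\<close>, while
    \<open>A\<close> has the same norm as \<open>W\<close>.\<close>
  define A where "A = bv_mult k (adj W) U"
  have D: "D > 0" using card_bitvecs_pos by (simp add: D_def)
  have AL: "eq_bv k (bv_mult k (adj A) L) (\<lambda>y x. c * bvI y x)"
  proof -
    have 1: "bv_mult k (adj A) L = bv_mult k (adj U) (bv_mult k W L)"
      unfolding A_def adj_mult adj_adj bv_mult_assoc ..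
    have "eq_bv k (bv_mult k (adj A) L) (bv_mult k (adj U) (\<lambda>y x. c * U y x))"
      unfolding 1 by (rule bv_mult_cong[OF eq_bv_refl WL])
    also have "\<dots> = (\<lambda>y x. c * bv_mult k (adj U) U y x)"
      by (intro ext) (simp add: bv_mult_def sum_distrib_left mult_ac)
    also have "eq_bv k \<dots> (\<lambda>y x. c * bvI y x)"
      using U by (simp add: unitary_bv_iff eq_bv_def)
    finally show ?thesis .
  qed
  have t: "hs_inner k A L = c * D"
    using AL by (simp add: hs_inner_def eq_bv_def bvI_def D_def mult.commute)
  have hsA: "hs2 k A = hs2 k W"
  proof -
    have "complex_of_real (hs2 k A) = (\<Sum>x\<in>?B. bv_mult k A (adj A) x x)"
      unfolding hs2_eq hs_inner_def bv_mult_def adj_def by (subst sum.swap) (simp add: mult.commute)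
    also have "\<dots> = (\<Sum>x\<in>?B. bv_mult k (adj W) W x x)"
    proof (intro sum.cong refl)
      fix x assume x: "x \<in> ?B"
      have 1: "bv_mult k A (adj A) = bv_mult k (bv_mult k (adj W) (bv_mult k U (adj U))) W"
        unfolding A_def adj_mult adj_adj bv_mult_assoc ..
      have UU: "eq_bv k (bv_mult k U (adj U)) bvI" using U by (simp add: unitary_bv_iff)
      have "eq_bv k (bv_mult k A (adj A)) (bv_mult k (bv_mult k (adj W) bvI) W)"
        unfolding 1 by (rule bv_mult_cong[OF bv_mult_cong[OF eq_bv_refl UU] eq_bv_refl])
      also have "eq_bv k \<dots> (bv_mult k (adj W) W)"
        by (rule bv_mult_cong[OF bv_mult_I_right eq_bv_refl])
      finally show "bv_mult k A (adj A) x x = bv_mult k (adj W) W x x"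
        using x by (simp add: eq_bv_def)
    qed
    also have "\<dots> = complex_of_real (hs2 k W)" unfolding hs2_eq hs_inner_def ..
    finally show ?thesis by (simp only: of_real_eq_iff)
  qed
  have zero: "c = 0" if "hs2 k A = 0"
  proof -
    have "eq_bv k A (\<lambda>y x. 0)" using that by (simp add: hs2_eq_0_iff)
    then have "hs_inner k A L = 0" by (simp add: hs_inner_eq eq_bv_def)
    then show ?thesis using t D by simp
  qed
  have CS: "hs2 k (\<lambda>y x. L y x - c * D / hs2 k A * A y x) = hs2 k L - (cmod c)\<^sup>2 * D\<^sup>2 / hs2 k A" if "hs2 k A > 0"
    using hs_Cauchy_Schwarz[OF that, of L] D by (simp add: t norm_mult power_mult_distrib)
  show "(cmod c)\<^sup>2 * D\<^sup>2 \<le> hs2 k W * hs2 k L"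
  proof (cases "hs2 k A = 0")
    case True
    then show ?thesis using zero hsA by simp
  next
    case False
    then have "hs2 k A > 0" using hs2_nonneg[of k A] by simp
    then have "(cmod c)\<^sup>2 * D\<^sup>2 / hs2 k A \<le> hs2 k L"
      using CS hs2_nonneg[of k "\<lambda>y x. L y x - c * D / hs2 k A * A y x"] by simp
    then show ?thesis using \<open>hs2 k A > 0\<close> hsA by (simp add: pos_divide_le_eq mult.commute)
  qed
  show "\<exists>\<gamma>. \<gamma> \<noteq> 0 \<and> unitary_bv k (\<lambda>y x. L y x / \<gamma>)"
    if c: "c \<noteq> 0" and eq: "(cmod c)\<^sup>2 * D\<^sup>2 = hs2 k W * hs2 k L"
  proof -
    have pos: "hs2 k A > 0" using zero c hs2_nonneg[of k A] by force
    define \<mu> where "\<mu> = D / hs2 k A"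
    have \<mu>: "\<mu> > 0" using pos D by (simp add: \<mu>_def)
    have "hs2 k (\<lambda>y x. L y x - c * D / hs2 k A * A y x) = 0"
      using CS[OF pos] pos by (simp add: eq hsA)
    then have LA: "L y x = c * \<mu> * A y x" if "y \<in> ?B" "x \<in> ?B" for y x
      using that by (simp add: hs2_eq_0_iff eq_bv_def \<mu>_def)
    \<comment> \<open>The vanishing residual gave \<open>L = c * \<mu> * A\<close>, so
      \<open>adj L\<close> times \<open>L\<close> is \<open>\<mu>\<close> |c|^2 times the identity.
      Dividing by a scalar of squared modulus \<open>\<mu>\<close> |c|^2 yields an isometry.\<close>
    define \<gamma> where "\<gamma> = c * complex_of_real (sqrt \<mu>)"
    have \<gamma>: "\<gamma> \<noteq> 0" using c \<mu> by (simp add: \<gamma>_def)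
    have "eq_bv k (bv_mult k (adj (\<lambda>y x. L y x / \<gamma>)) (\<lambda>y x. L y x / \<gamma>)) bvI"
      unfolding eq_bv_def
    proof (intro ballI)
      fix y x assume yx: "y \<in> ?B" "x \<in> ?B"
      \<comment> \<open>Only the left copy of \<open>L\<close> is rewritten through
        \<open>A\<close>; the remaining product of \<open>adj A\<close> with \<open>L\<close> is
        already known.\<close>
      have "bv_mult k (adj (\<lambda>y x. L y x / \<gamma>)) (\<lambda>y x. L y x / \<gamma>) y x
        = (\<Sum>z\<in>?B. cnj (c * \<mu>) / (cnj \<gamma> * \<gamma>) * (cnj (A z y) * L z x))"
        unfolding bv_mult_def adj_def by (intro sum.cong) (auto simp: LA[OF _ yx(1)])
      also have "\<dots> = cnj (c * \<mu>) / (cnj \<gamma> * \<gamma>) * bv_mult k (adj A) L y x"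
        by (simp add: bv_mult_def adj_def sum_distrib_left)
      also have "bv_mult k (adj A) L y x = c * bvI y x" using AL yx by (simp add: eq_bv_def)
      also have "cnj \<gamma> * \<gamma> = cnj c * c * complex_of_real (sqrt \<mu> * sqrt \<mu>)"
        by (simp only: \<gamma>_def complex_cnj_mult complex_cnj_complex_of_real of_real_mult mult_ac)
      also have "sqrt \<mu> * sqrt \<mu> = \<mu>" using \<mu> by simp
      finally show "bv_mult k (adj (\<lambda>y x. L y x / \<gamma>)) (\<lambda>y x. L y x / \<gamma>) y x = bvI y x"
        using c \<mu> by simp
    qed
    then show ?thesis using \<gamma> unitary_bv_if_isometry by blast
  qed
qed

section \<open>Binary codes and path sums\<close>

text \<open>Offset of port \<open>p\<close> in the packed binary index of a node, where absent ports
  occupy no bit; \<open>code\<close> performs the packing.\<close>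

definition pos :: "(nat \<Rightarrow> bool) \<Rightarrow> nat \<Rightarrow> nat" where
  "pos P p = length (filter P [0..<p])"

definition code :: "(nat \<Rightarrow> bool) \<Rightarrow> nat \<Rightarrow> (nat \<Rightarrow> nat) \<Rightarrow> nat" where
  "code P m f = (\<Sum>p<m. if P p then f p * 2 ^ pos P p else 0)"

lemma pos_Suc: "pos P (Suc p) = pos P p + (if P p then 1 else 0)"
  by (simp add: pos_def)

lemma pos_mono: "p \<le> q \<Longrightarrow> pos P p \<le> pos P q"
  by (induction rule: dec_induct) (auto simp: pos_Suc)

lemma code_cong: "(\<And>p. p < m \<Longrightarrow> P p \<Longrightarrow> f p = g p) \<Longrightarrow> code P m f = code P m g"
  unfolding code_def by (intro sum.cong) auto

lemma code_0: "code P 0 f = 0"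
  and code_Suc: "code P (Suc m) f = code P m f + (if P m then f m * 2 ^ pos P m else 0)"
  by (simp_all add: code_def)

lemma code_decode: "code P m (\<lambda>p. n div 2 ^ pos P p mod 2) = n mod 2 ^ pos P m"
proof (induction m)
  case (Suc m)
  have "n mod (2 ^ pos P m * 2) = 2 ^ pos P m * (n div 2 ^ pos P m mod 2) + n mod 2 ^ pos P m"
    by (rule mod_mult2_eq)
  then show ?case using Suc by (simp add: code_Suc pos_Suc mult.commute)
qed (simp add: code_0 pos_def)

lemma code_less:
  assumes "\<And>p. p < m \<Longrightarrow> P p \<Longrightarrow> f p < 2"
  shows "code P m f < 2 ^ pos P m"
  using assms
proof (induction m)
  case (Suc m)
  have "code P m f < 2 ^ pos P m" using Suc by simp
  moreover have "f m = 0 \<or> f m = 1" if "P m"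
    using Suc.prems[of m] that by auto
  ultimately show ?case by (auto simp: code_Suc pos_Suc)
qed (simp add: code_0 pos_def)

text \<open>Bits of earlier ports sum to less than \<open>2 ^ pos P q\<close>, and later ports
  contribute multiples of twice that power, so neither affects the digit read at
  \<open>q\<close>.\<close>

lemma decode_code:
  assumes "\<And>p. p < m \<Longrightarrow> P p \<Longrightarrow> f p < 2" "q < m" "P q"
  shows "code P m f div 2 ^ pos P q mod 2 = f q"
  using assms
proof (induction m)
  case (Suc m)
  show ?case
  proof (cases "q = m")
    case True
    have "code P m f < 2 ^ pos P m" using Suc.prems by (intro code_less) auto
    then show ?thesis using True Suc.prems by (auto simp: code_Suc)
  next
    case False
    then have q: "q < m" using Suc.prems by simp
    have IH: "code P m f div 2 ^ pos P q mod 2 = f q" using Suc q by simp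
    show ?thesis
    proof (cases "P m")
      case True
      have "pos P (Suc q) \<le> pos P m" using q by (intro pos_mono) simp
      then have "pos P m = pos P q + Suc (pos P m - pos P (Suc q))"
        using Suc.prems(3) by (simp add: pos_Suc)
      then obtain e where e: "(2::nat) ^ pos P m = 2 ^ pos P q * (2 * e)"
        by (metis power_Suc power_add)
      have "code P (Suc m) f = code P m f + 2 ^ pos P q * (2 * (e * f m))"
        using True by (simp add: code_Suc e)
      then show ?thesis using IH by simp
    next
      case False
      then show ?thesis using IH by (simp add: code_Suc)
    qed
  qed
qed simp

section \<open>Matrix products as sums over paths\<close>

lemma sum_PiE_insert:
  assumes "a \<notin> S"
  shows "(\<Sum>f\<in>Pi\<^sub>E (insert a S) T. F f) = (\<Sum>c\<in>T a. \<Sum>f\<in>Pi\<^sub>E S T. F (f(a := c)))"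
  using inj_combinator[OF assms, of T]
  by (simp add: PiE_insert_eq sum.reindex sum.cartesian_product case_prod_unfold)

text \<open>Unfolds to the product of \<open>M n\<close>, \<open>G (n - 1)\<close>, ...,
  \<open>M 1\<close>, \<open>G 0\<close> in this order. The rightmost \<open>G 0\<close> is an extra
  bond for the input.\<close>

fun chain :: "nat \<Rightarrow> (nat \<Rightarrow> bv \<Rightarrow> bv \<Rightarrow> complex) \<Rightarrow> (nat \<Rightarrow> bv \<Rightarrow> bv \<Rightarrow> complex) \<Rightarrow> nat \<Rightarrow> bv \<Rightarrow> bv \<Rightarrow> complex" where
  "chain k M G 0 = bvI"
| "chain k M G (Suc n) = bv_mult k (bv_mult k (M (Suc n)) (G n)) (chain k M G n)"

text \<open>Here \<open>l j\<close> and \<open>r j\<close> are the indices at the left and right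
  ends of column \<open>j\<close>. Bond \<open>j - 1\<close> joins the right end of column
  \<open>j - 1\<close>, or the input \<open>x\<close>, to the left end of column
  \<open>j\<close>.\<close>

definition bond_weight :: "(nat \<Rightarrow> bv \<Rightarrow> bv \<Rightarrow> 'a::comm_monoid_mult) \<Rightarrow> nat \<Rightarrow> bv \<Rightarrow> (nat \<Rightarrow> bv) \<Rightarrow> (nat \<Rightarrow> bv) \<Rightarrow> 'a" where
  "bond_weight G n x l r = (\<Prod>j\<in>{1..n}. G (j - 1) (l j) (if j = 1 then x else r (j - 1)))"

lemma bond_weight_Suc:
  "bond_weight G (Suc n) x l r = bond_weight G n x l r * G n (l (Suc n)) (if n = 0 then x else r n)"
  by (simp add: bond_weight_def)

lemma bond_weight_cong:
  "(\<And>j. 1 \<le> j \<Longrightarrow> j \<le> n \<Longrightarrow> l j = l' j) \<Longrightarrow> (\<And>j. 1 \<le> j \<Longrightarrow> j < n \<Longrightarrow> r j = r' j) \<Longrightarrow>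
    bond_weight G n x l r = bond_weight G n x l' r'"
  unfolding bond_weight_def by (intro prod.cong) auto

text \<open>The test function \<open>h\<close> on the final index makes the induction work: peeling
  off the last column leaves the same kind of sum with \<open>h\<close> replaced by a row
  \<open>G n lc\<close>.\<close>

lemma path_sum:
  assumes x: "x \<in> bitvecs k"
  shows "(\<Sum>l\<in>{1..n} \<rightarrow>\<^sub>E bitvecs k. \<Sum>r\<in>{1..n} \<rightarrow>\<^sub>E bitvecs k.
      h (if n = 0 then x else r n) * (\<Prod>j\<in>{1..n}. M j (r j) (l j)) * bond_weight G n x l r)
    = (\<Sum>y\<in>bitvecs k. h y * chain k M G n y x)"
proof (induction n arbitrary: h)
  case 0
  have "(\<Sum>y\<in>bitvecs k. h y * bvI y x) = (\<Sum>y\<in>bitvecs k. if y = x then h y else 0)"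
    by (intro sum.cong) (auto simp: bvI_def)
  then show ?case using x by (simp add: bond_weight_def)
next
  case (Suc n)
  let ?B = "bitvecs k" and ?S = "{1..n} \<rightarrow>\<^sub>E bitvecs k"
  let ?m = "\<lambda>l r. \<Prod>j\<in>{1..n}. M j (r j) (l j)" and ?z = "\<lambda>r. if n = 0 then x else r n"
  have ins: "{1..Suc n} = insert (Suc n) {1..n}" by auto
  have "(\<Sum>l\<in>{1..Suc n} \<rightarrow>\<^sub>E ?B. \<Sum>r\<in>{1..Suc n} \<rightarrow>\<^sub>E ?B.
      h (if Suc n = 0 then x else r (Suc n)) * (\<Prod>j\<in>{1..Suc n}. M j (r j) (l j)) * bond_weight G (Suc n) x l r)
    = (\<Sum>lc\<in>?B. \<Sum>l\<in>?S. \<Sum>y\<in>?B. \<Sum>r\<in>?S. h y * M (Suc n) y lc * (G n lc (?z r) * ?m l r * bond_weight G n x l r))"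
  proof -
    have m: "?m (l(Suc n := c)) (r(Suc n := c')) = ?m l r" for l r c c'
      by (intro prod.cong) auto
    have w: "bond_weight G n x (l(Suc n := c)) (r(Suc n := c')) = bond_weight G n x l r" for l r c c'
      by (intro bond_weight_cong) auto
    have notin: "Suc n \<notin> {1..n}" by simp
    show ?thesis
      unfolding ins sum_PiE_insert[OF notin]
      by (intro sum.cong refl) (simp add: m w bond_weight_Suc mult_ac)
  qed
  also have "\<dots> = (\<Sum>y\<in>?B. \<Sum>lc\<in>?B. h y * M (Suc n) y lc * (\<Sum>l\<in>?S. \<Sum>r\<in>?S. G n lc (?z r) * ?m l r * bond_weight G n x l r))"
    unfolding sum_distrib_left
    by (subst sum.swap[of _ ?B ?B], rule sum.cong[OF refl], rule sum.swap)
  also have "\<dots> = (\<Sum>y\<in>?B. \<Sum>lc\<in>?B. h y * M (Suc n) y lc * (\<Sum>z\<in>?B. G n lc z * chain k M G n z x))"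
    by (simp only: Suc.IH)
  also have "\<dots> = (\<Sum>y\<in>?B. h y * bv_mult k (M (Suc n)) (bv_mult k (G n) (chain k M G n)) y x)"
    by (simp add: bv_mult_def sum_distrib_left mult.assoc)
  finally show ?case by (simp add: bv_mult_assoc)
qed

text \<open>Choosing for \<open>h\<close> the indicator of \<open>y\<close> fixes the last right
  index, so \<open>r\<close> ranges only over the columns before \<open>N\<close>.\<close>

lemma path_sum_endpoint:
  assumes x: "x \<in> bitvecs k" and y: "y \<in> bitvecs k" and N: "N \<ge> 1"
  shows "(\<Sum>l\<in>{1..N} \<rightarrow>\<^sub>E bitvecs k. \<Sum>r\<in>{1..<N} \<rightarrow>\<^sub>E bitvecs k.
      (\<Prod>j\<in>{1..N}. M j (if j = N then y else r j) (l j)) * bond_weight G N x l r) = chain k M G N y x"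
proof -
  let ?B = "bitvecs k"
  have ins: "{1..N} = insert N {1..<N}" using N by auto
  have "chain k M G N y x = (\<Sum>y'\<in>?B. (if y' = y then 1 else 0) * chain k M G N y' x)"
    using y by (simp add: if_distrib[of "\<lambda>c. c * _"] cong: if_cong)
  also have "\<dots> = (\<Sum>l\<in>{1..N} \<rightarrow>\<^sub>E ?B. \<Sum>r\<in>{1..N} \<rightarrow>\<^sub>E ?B.
      (if r N = y then 1 else 0) * (\<Prod>j\<in>{1..N}. M j (r j) (l j)) * bond_weight G N x l r)"
    using N by (subst path_sum[OF x, symmetric]) (simp cong: if_cong)
  also have "\<dots> = (\<Sum>l\<in>{1..N} \<rightarrow>\<^sub>E ?B. \<Sum>r\<in>{1..<N} \<rightarrow>\<^sub>E ?B. \<Sum>c\<in>?B.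
      if c = y then (\<Prod>j\<in>{1..N}. M j (if j = N then c else r j) (l j)) * bond_weight G N x l r else 0)"
  proof (rule sum.cong[OF refl])
    fix l
    have w: "bond_weight G N x l (r(N := c)) = bond_weight G N x l r" for r c
      by (intro bond_weight_cong) auto
    have "(\<Sum>r\<in>{1..N} \<rightarrow>\<^sub>E ?B. (if r N = y then 1 else 0) * (\<Prod>j\<in>{1..N}. M j (r j) (l j)) * bond_weight G N x l r)
      = (\<Sum>c\<in>?B. \<Sum>r\<in>{1..<N} \<rightarrow>\<^sub>E ?B. (if (r(N := c)) N = y then 1 else 0) * (\<Prod>j\<in>{1..N}. M j ((r(N := c)) j) (l j)) * bond_weight G N x l (r(N := c)))"
      by (subst (1) ins, subst sum_PiE_insert) simp_all
    also have "\<dots> = (\<Sum>r\<in>{1..<N} \<rightarrow>\<^sub>E ?B. \<Sum>c\<in>?B.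
      if c = y then (\<Prod>j\<in>{1..N}. M j (if j = N then c else r j) (l j)) * bond_weight G N x l r else 0)"
      unfolding w by (subst sum.swap, intro sum.cong refl) simp
    finally show "(\<Sum>r\<in>{1..N} \<rightarrow>\<^sub>E ?B. (if r N = y then 1 else 0) * (\<Prod>j\<in>{1..N}. M j (r j) (l j)) * bond_weight G N x l r)
      = (\<Sum>r\<in>{1..<N} \<rightarrow>\<^sub>E ?B. \<Sum>c\<in>?B.
      if c = y then (\<Prod>j\<in>{1..N}. M j (if j = N then c else r j) (l j)) * bond_weight G N x l r else 0)" .
  qed
  also have "\<dots> = (\<Sum>l\<in>{1..N} \<rightarrow>\<^sub>E bitvecs k. \<Sum>r\<in>{1..<N} \<rightarrow>\<^sub>E bitvecs k.
      (\<Prod>j\<in>{1..N}. M j (if j = N then y else r j) (l j)) * bond_weight G N x l r)"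
    using y by simp
  finally show ?thesis ..
qed

text \<open>All-ones columns decouple neighbouring bonds, so each \<open>G j\<close> enters only
  through the sum of its entries. Applied to squared moduli, this computes norms of bond
  states.\<close>

lemma chain_ones:
  assumes "x \<in> bitvecs k" "G 0 = bvI"
  shows "chain k (\<lambda>_ _ _. 1) G (Suc n) y x = (\<Prod>j\<in>{1..n}. \<Sum>u\<in>bitvecs k. \<Sum>v\<in>bitvecs k. G j u v)"
proof (induction n arbitrary: y)
  case 0
  have "chain k (\<lambda>_ _ _. 1) G (Suc 0) y x = bv_mult k (\<lambda>_ _. 1) bvI y x"
    using bv_mult_I_right[of k "bv_mult k (\<lambda>_ _. 1) bvI"] assms
    by (simp add: bv_mult_def bvI_def sum_distrib_right if_distrib[where f = "\<lambda>c. _ * c"] cong: if_cong)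
  also have "\<dots> = 1"
  proof -
    have "bv_mult k (\<lambda>_ _. 1) bvI y x = (\<Sum>z\<in>bitvecs k. if z = x then 1 else 0)"
      unfolding bv_mult_def bvI_def by (rule sum.cong) auto
    then show ?thesis using assms by simp
  qed
  finally show ?case by simp
next
  case (Suc n)
  have "chain k (\<lambda>_ _ _. 1) G (Suc (Suc n)) y x
     = (\<Sum>v\<in>bitvecs k. (\<Sum>u\<in>bitvecs k. G (Suc n) u v) * chain k (\<lambda>_ _ _. 1) G (Suc n) v x)"
    by (subst chain.simps) (simp add: bv_mult_def[of k _ _ y])
  also have "\<dots> = (\<Sum>v\<in>bitvecs k. \<Sum>u\<in>bitvecs k. G (Suc n) u v) * (\<Prod>j\<in>{1..n}. \<Sum>u\<in>bitvecs k. \<Sum>v\<in>bitvecs k. G j u v)"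
    by (simp only: Suc.IH sum_distrib_right)
  finally show ?case by (subst (asm) sum.swap) (simp add: mult.commute)
qed

section \<open>States on the bonds of the network\<close>

lemma pbit_eq: "pbit k N v p n = n div 2 ^ pos (port_used k N v) p mod 2"
  by (simp add: pbit_def npos_def pos_def)

lemma d0_eq: "d0 k N v = 2 ^ pos (port_used k N v) 5"
  by (simp add: d0_def nports_def pos_def)

lemma pbit_less: "pbit k N v p n < 2"
  by (simp add: pbit_def)

definition vertical_match :: "nat \<Rightarrow> nat \<Rightarrow> gidx \<Rightarrow> bool" where
  "vertical_match k N b \<longleftrightarrow> (\<forall>i j. 1 \<le> i \<and> i < k \<and> 1 \<le> j \<and> j \<le> N \<longrightarrow>
     pbit k N (i,j) 2 (b (i,j)) = pbit k N (i+1,j) 1 (b (i+1,j)))"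

text \<open>In column 1 the input port 0 acts as the left port, so the input is handled like one
  more bond.\<close>

definition left_bits :: "nat \<Rightarrow> nat \<Rightarrow> gidx \<Rightarrow> nat \<Rightarrow> bv" where
  "left_bits k N b j = (\<lambda>i. if 1 \<le> i \<and> i \<le> k then pbit k N (i,j) (if j = 1 then 0 else 3) (b (i,j)) else 0)"

definition right_bits :: "nat \<Rightarrow> nat \<Rightarrow> gidx \<Rightarrow> nat \<Rightarrow> bv" where
  "right_bits k N b j = (\<lambda>i. if 1 \<le> i \<and> i \<le> k then pbit k N (i,j) 4 (b (i,j)) else 0)"

definition down_bits :: "nat \<Rightarrow> nat \<Rightarrow> gidx \<Rightarrow> nat \<Rightarrow> bv" where
  "down_bits k N b j = (\<lambda>i. if 1 \<le> i \<and> i \<le> k - 1 then pbit k N (i,j) 2 (b (i,j)) else 0)"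

text \<open>Ports 0 and 3 share the value \<open>l\<close>: a node in column 1 has the input port,
  any other node the left port, never both.\<close>

definition port_val :: "nat \<Rightarrow> nat \<Rightarrow> nat \<Rightarrow> nat \<Rightarrow> nat \<Rightarrow> nat" where
  "port_val l r u d p = (if p = 1 then u else if p = 2 then d else if p = 4 then r else l)"

definition node_code :: "nat \<Rightarrow> nat \<Rightarrow> node \<Rightarrow> nat \<Rightarrow> nat \<Rightarrow> nat \<Rightarrow> nat \<Rightarrow> nat" where
  "node_code k N v l r u d = code (port_used k N v) 5 (port_val l r u d)"

text \<open>Inverse of reading off the left, right and down bits. The up bit of row \<open>i\<close>
  is the down bit of row \<open>i - 1\<close>, so vertical edges match by construction.\<close>

definition encode :: "nat \<Rightarrow> nat \<Rightarrow> (nat \<Rightarrow> bv) \<Rightarrow> (nat \<Rightarrow> bv) \<Rightarrow> (nat \<Rightarrow> bv) \<Rightarrow> gidx" where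
  "encode k N l r a v = (case v of (i,j) \<Rightarrow>
     if v \<in> nodes k N then node_code k N v (l j i) (r j i) (a j (i - 1)) (a j i) else 0)"

lemma bitvec_less: "x \<in> bitvecs k \<Longrightarrow> x i < 2"
  by (cases "1 \<le> i \<and> i \<le> k") (auto simp: bitvecs_def)

lemma less_5_iff: "(p::nat) < 5 \<longleftrightarrow> p = 0 \<or> p = 1 \<or> p = 2 \<or> p = 3 \<or> p = 4"
  by auto

lemma pbit_node_code:
  assumes "l < 2" "r < 2" "u < 2" "d < 2" "q < 5" "port_used k N v q"
  shows "pbit k N v q (node_code k N v l r u d) = port_val l r u d q"
  unfolding pbit_eq node_code_def
  by (rule decode_code) (use assms in \<open>auto simp: port_val_def\<close>)

lemma node_code_less:
  assumes "l < 2" "r < 2" "u < 2" "d < 2"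
  shows "node_code k N v l r u d < d0 k N v"
  unfolding d0_eq node_code_def
  by (rule code_less) (use assms in \<open>auto simp: port_val_def\<close>)

lemma left_bits_bitvec: "left_bits k N b j \<in> bitvecs k"
  and right_bits_bitvec: "right_bits k N b j \<in> bitvecs k"
  and down_bits_bitvec: "down_bits k N b j \<in> bitvecs (k - 1)"
  by (auto simp: bitvecs_def left_bits_def right_bits_def down_bits_def pbit_less)

lemma
  assumes "\<And>j. 1 \<le> j \<Longrightarrow> j \<le> N \<Longrightarrow> l j \<in> bitvecs k"
    and "\<And>j. 1 \<le> j \<Longrightarrow> j < N \<Longrightarrow> r j \<in> bitvecs k"
    and "\<And>j. 1 \<le> j \<Longrightarrow> j \<le> N \<Longrightarrow> a j \<in> bitvecs (k - 1)"
  shows encode_gbasis: "encode k N l r a \<in> gbasis k N (d0 k N)" (is ?A)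
    and vertical_match_encode: "vertical_match k N (encode k N l r a)" (is ?B)
    and left_bits_encode: "1 \<le> j \<Longrightarrow> j \<le> N \<Longrightarrow> left_bits k N (encode k N l r a) j = l j" (is "_ \<Longrightarrow> _ \<Longrightarrow> ?C")
    and right_bits_encode: "1 \<le> j \<Longrightarrow> j < N \<Longrightarrow> right_bits k N (encode k N l r a) j = r j" (is "_ \<Longrightarrow> _ \<Longrightarrow> ?D")
    and down_bits_encode: "1 \<le> j \<Longrightarrow> j \<le> N \<Longrightarrow> down_bits k N (encode k N l r a) j = a j" (is "_ \<Longrightarrow> _ \<Longrightarrow> ?E")
proof -
  let ?e = "encode k N l r a"
  have less: "l j i < 2" "j < N \<Longrightarrow> r j i < 2" "a j i < 2" if "1 \<le> j" "j \<le> N" for i j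
    using assms that bitvec_less by blast+
  have bit: "pbit k N (i,j) p (?e (i,j)) = port_val (l j i) (r j i) (a j (i - 1)) (a j i) p"
    if "1 \<le> i" "i \<le> k" "1 \<le> j" "j \<le> N" "p < 5" "port_used k N (i,j) p" for i j p
  proof -
    \<comment> \<open>The value \<open>r N\<close> is arbitrary and may exceed 1. Column
      \<open>N\<close> has no right port, so the code is unchanged when this value is replaced by
      0.\<close>
    have "node_code k N (i,j) (l j i) (r j i) (a j (i - 1)) (a j i)
        = node_code k N (i,j) (l j i) (if j < N then r j i else 0) (a j (i - 1)) (a j i)"
      unfolding node_code_def by (rule code_cong) (auto simp: port_val_def port_used_def Let_def)
    moreover have "port_val (l j i) (if j < N then r j i else 0) (a j (i - 1)) (a j i) p
        = port_val (l j i) (r j i) (a j (i - 1)) (a j i) p"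
      using that(6) by (auto simp: port_val_def port_used_def Let_def)
    ultimately show ?thesis
      using that less[of j] by (simp add: encode_def nodes_def pbit_node_code)
  qed
  show ?A
  proof -
    have "?e (i,j) < d0 k N (i,j)" if "(i,j) \<in> nodes k N" for i j
    proof -
      have "node_code k N (i,j) (l j i) (r j i) (a j (i - 1)) (a j i)
          = node_code k N (i,j) (l j i) (if j < N then r j i else 0) (a j (i - 1)) (a j i)"
        unfolding node_code_def by (rule code_cong) (auto simp: port_val_def port_used_def Let_def)
      then show ?thesis
        using that less[of j] by (simp add: encode_def nodes_def node_code_less)
    qed
    then show ?thesis by (auto simp: gbasis_def encode_def)
  qed
  show ?B
    unfolding vertical_match_def by (auto simp: bit port_used_def port_val_def Let_def)
  show ?C if "1 \<le> j" "j \<le> N"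
  proof
    fix i show "left_bits k N ?e j i = l j i"
      using that assms(1)[of j] by (auto simp: left_bits_def bit port_used_def port_val_def Let_def bitvecs_def)
  qed
  show ?D if "1 \<le> j" "j < N"
  proof
    fix i show "right_bits k N ?e j i = r j i"
      using that assms(2)[of j] by (auto simp: right_bits_def bit port_used_def port_val_def Let_def bitvecs_def)
  qed
  show ?E if "1 \<le> j" "j \<le> N"
  proof
    fix i show "down_bits k N ?e j i = a j i"
      using that assms(3)[of j] by (auto simp: down_bits_def bit port_used_def port_val_def Let_def bitvecs_def)
  qed
qed

lemma encode_decode:
  assumes "b \<in> gbasis k N (d0 k N)" "vertical_match k N b"
    and "\<And>j. 1 \<le> j \<Longrightarrow> j \<le> N \<Longrightarrow> l j = left_bits k N b j"
    and "\<And>j. 1 \<le> j \<Longrightarrow> j < N \<Longrightarrow> r j = right_bits k N b j"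
    and "\<And>j. 1 \<le> j \<Longrightarrow> j \<le> N \<Longrightarrow> a j = down_bits k N b j"
  shows "encode k N l r a = b"
proof
  fix v :: node
  obtain i j where v: "v = (i, j)" by (cases v)
  show "encode k N l r a v = b v"
  proof (cases "v \<in> nodes k N")
    case False
    then show ?thesis using assms(1) by (simp add: encode_def gbasis_def v)
  next
    case True
    then have ij: "1 \<le> i" "i \<le> k" "1 \<le> j" "j \<le> N" by (auto simp: nodes_def v)
    have *: "port_val (l j i) (r j i) (a j (i - 1)) (a j i) p = b v div 2 ^ pos (port_used k N v) p mod 2"
      if p: "p < 5" "port_used k N v p" for p
    proof -
      consider "p = 0" "j = 1" | "p = 1" "i > 1" | "p = 2" "i < k" | "p = 3" "j > 1" | "p = 4" "j < N"
        using p unfolding less_5_iff by (auto simp: port_used_def v Let_def)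
      then show ?thesis
      proof cases
        case 2
        then have "pbit k N (i - 1, j) 2 (b (i - 1, j)) = pbit k N (i, j) 1 (b (i, j))"
          using spec[OF spec[OF assms(2)[unfolded vertical_match_def], of "i - 1"], of j] ij by auto
        moreover have "1 \<le> i - 1" "i - 1 \<le> k - 1" using 2 ij by auto
        ultimately show ?thesis using 2 ij assms(5)[of j] by (simp add: port_val_def down_bits_def pbit_eq v)
      qed (use ij assms(3-5)[of j] in \<open>auto simp: port_val_def left_bits_def right_bits_def down_bits_def pbit_eq v\<close>)
    qed
    have "encode k N l r a v = code (port_used k N v) 5 (\<lambda>p. b v div 2 ^ pos (port_used k N v) p mod 2)"
      using True * by (simp add: encode_def v node_code_def) (rule code_cong, simp add: v)
    also have "\<dots> = b v mod d0 k N v"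
      unfolding code_decode d0_eq ..
    also have "\<dots> = b v" using True assms(1) by (simp add: gbasis_def)
    finally show ?thesis .
  qed
qed

abbreviation configs :: "nat \<Rightarrow> nat \<Rightarrow> ((nat \<Rightarrow> bv) \<times> (nat \<Rightarrow> bv) \<times> (nat \<Rightarrow> bv)) set" where
  "configs k N \<equiv> ({1..N} \<rightarrow>\<^sub>E bitvecs k) \<times> ({1..<N} \<rightarrow>\<^sub>E bitvecs k) \<times> ({1..N} \<rightarrow>\<^sub>E bitvecs (k - 1))"

text \<open>\<open>encode\<close> and the bit-reading functions are mutually inverse once the
  families are restricted to their index ranges. Up bits need no record because
  \<open>vertical_match\<close> determines them.\<close>

lemma sum_vertical_match:
  "(\<Sum>b | b \<in> gbasis k N (d0 k N) \<and> vertical_match k N b. F b)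
    = (\<Sum>(l, r, a)\<in>configs k N. F (encode k N l r a))"
proof (rule sum.reindex_bij_witness[where i = "\<lambda>(l, r, a). encode k N l r a"
      and j = "\<lambda>b. (restrict (left_bits k N b) {1..N}, restrict (right_bits k N b) {1..<N}, restrict (down_bits k N b) {1..N})"])
  fix b assume b: "b \<in> {b \<in> gbasis k N (d0 k N). vertical_match k N b}"
  show "(case (restrict (left_bits k N b) {1..N}, restrict (right_bits k N b) {1..<N}, restrict (down_bits k N b) {1..N})
      of (l, r, a) \<Rightarrow> encode k N l r a) = b"
    using b by (auto intro!: encode_decode)
  then show "(case (restrict (left_bits k N b) {1..N}, restrict (right_bits k N b) {1..<N}, restrict (down_bits k N b) {1..N})
      of (l, r, a) \<Rightarrow> F (encode k N l r a)) = F b" by simp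
  show "(restrict (left_bits k N b) {1..N}, restrict (right_bits k N b) {1..<N}, restrict (down_bits k N b) {1..N}) \<in> configs k N"
    by (auto simp: left_bits_bitvec right_bits_bitvec down_bits_bitvec simp del: One_nat_def)
next
  fix t assume t: "t \<in> configs k N"
  obtain l r a where t_eq: "t = (l, r, a)" by (cases t)
  have l: "l \<in> {1..N} \<rightarrow>\<^sub>E bitvecs k" and r: "r \<in> {1..<N} \<rightarrow>\<^sub>E bitvecs k" and a: "a \<in> {1..N} \<rightarrow>\<^sub>E bitvecs (k - 1)"
    using t by (auto simp: t_eq)
  have mem: "\<And>j. 1 \<le> j \<Longrightarrow> j \<le> N \<Longrightarrow> l j \<in> bitvecs k" "\<And>j. 1 \<le> j \<Longrightarrow> j < N \<Longrightarrow> r j \<in> bitvecs k"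
      "\<And>j. 1 \<le> j \<Longrightarrow> j \<le> N \<Longrightarrow> a j \<in> bitvecs (k - 1)"
    using PiE_mem[OF l] PiE_mem[OF r] PiE_mem[OF a] by auto
  show "(case t of (l, r, a) \<Rightarrow> encode k N l r a) \<in> {b \<in> gbasis k N (d0 k N). vertical_match k N b}"
    using encode_gbasis[OF mem] vertical_match_encode[OF mem] by (simp add: t_eq)
  have "restrict (left_bits k N (encode k N l r a)) {1..N} = l"
    using l by (intro PiE_ext[OF restrict_PiE_iff[THEN iffD2] l]) (auto simp: left_bits_bitvec left_bits_encode[OF mem])
  moreover have "restrict (right_bits k N (encode k N l r a)) {1..<N} = r"
    using r by (intro PiE_ext[OF restrict_PiE_iff[THEN iffD2] r]) (auto simp: right_bits_bitvec right_bits_encode[OF mem])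
  moreover have "restrict (down_bits k N (encode k N l r a)) {1..N} = a"
    using a by (intro PiE_ext[OF restrict_PiE_iff[THEN iffD2] a]) (auto simp: down_bits_bitvec down_bits_encode[OF mem])
  ultimately show "(restrict (left_bits k N (case t of (l, r, a) \<Rightarrow> encode k N l r a)) {1..N},
      restrict (right_bits k N (case t of (l, r, a) \<Rightarrow> encode k N l r a)) {1..<N},
      restrict (down_bits k N (case t of (l, r, a) \<Rightarrow> encode k N l r a)) {1..N}) = t"
    by (simp add: t_eq)
qed

text \<open>Vertical edges carry (unnormalised) EPR pairs and the \<open>j\<close>-th layer of horizontal edges carries the state with
  coefficient matrix \<open>G j\<close>. The fictitious bond \<open>0\<close> attaches the input: \<open>G 0 = 1\<close> makes it the basis vector \<open>x\<close>.\<close>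

definition bond_state :: "nat \<Rightarrow> nat \<Rightarrow> bv \<Rightarrow> (nat \<Rightarrow> bv \<Rightarrow> bv \<Rightarrow> complex) \<Rightarrow> gidx \<Rightarrow> complex" where
  "bond_state k N x G b = (if b \<in> gbasis k N (d0 k N) \<and> vertical_match k N b
     then bond_weight G N x (left_bits k N b) (right_bits k N b) else 0)"

text \<open>The argument \<open>r\<close> is the row index in every column: the right-bond bit when
  \<open>j < N\<close>, the output bit when \<open>j = N\<close>, where no right port
  exists.\<close>

definition site :: "nat \<Rightarrow> nat \<Rightarrow> (node \<Rightarrow> nat \<Rightarrow> nat \<Rightarrow> complex) \<Rightarrow> nat \<Rightarrow> nat \<Rightarrow> nat \<Rightarrow> nat \<Rightarrow> nat \<Rightarrow> nat \<Rightarrow> complex" where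
  "site k N B i j r l u d = B (i,j) (if j = N then r else 0) (node_code k N (i,j) l r u d)"

text \<open>Summing over \<open>a\<close> contracts the vertical edges of the column; the boundary
  values \<open>a 0\<close> and \<open>a k\<close> are 0 because \<open>a\<close> lies in
  \<open>bitvecs (k - 1)\<close>.\<close>

definition column :: "nat \<Rightarrow> nat \<Rightarrow> (node \<Rightarrow> nat \<Rightarrow> nat \<Rightarrow> complex) \<Rightarrow> nat \<Rightarrow> bv \<Rightarrow> bv \<Rightarrow> complex" where
  "column k N B j y x = (\<Sum>a\<in>bitvecs (k - 1). \<Prod>i\<in>{1..k}. site k N B i j (y i) (x i) (a (i - 1)) (a i))"

lemma prod_kraus_encode:
  "prod_kraus k N B y (encode k N l r a)
    = (\<Prod>j\<in>{1..N}. \<Prod>i\<in>{1..k}. site k N B i j (if j = N then y i else r j i) (l j i) (a j (i - 1)) (a j i))"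
proof -
  have "prod_kraus k N B y (encode k N l r a)
    = (\<Prod>(i,j)\<in>{1..k} \<times> {1..N}. site k N B i j (if j = N then y i else r j i) (l j i) (a j (i - 1)) (a j i))"
    unfolding prod_kraus_def nodes_eq
  proof (rule prod.cong[OF refl], clarify)
    fix i j assume ij: "i \<in> {1..k}" "j \<in> {1..N}"
    have "encode k N l r a (i,j) = node_code k N (i,j) (l j i) (r j i) (a j (i - 1)) (a j i)"
      using ij by (simp add: encode_def nodes_eq)
    \<comment> \<open>In column \<open>N\<close> there is no right port to encode, so
      \<open>r j i\<close> may be exchanged for the output bit, which gives \<open>site\<close> the
      same shape in all columns.\<close>
    also have "\<dots> = node_code k N (i,j) (l j i) (if j = N then y i else r j i) (a j (i - 1)) (a j i)"
      unfolding node_code_def by (rule code_cong) (auto simp: port_val_def port_used_def Let_def)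
    finally have e: "encode k N l r a (i,j) = node_code k N (i,j) (l j i) (if j = N then y i else r j i) (a j (i - 1)) (a j i)" .
    show "B (i,j) (if snd (i,j) = N then y (fst (i,j)) else 0) (encode k N l r a (i,j))
       = site k N B i j (if j = N then y i else r j i) (l j i) (a j (i - 1)) (a j i)"
      unfolding e site_def by simp
  qed
  also have "\<dots> = (\<Prod>i\<in>{1..k}. \<Prod>j\<in>{1..N}. site k N B i j (if j = N then y i else r j i) (l j i) (a j (i - 1)) (a j i))"
    by (rule prod.cartesian_product[symmetric])
  also have "\<dots> = (\<Prod>j\<in>{1..N}. \<Prod>i\<in>{1..k}. site k N B i j (if j = N then y i else r j i) (l j i) (a j (i - 1)) (a j i))"
    by (rule prod.swap)
  finally show ?thesis .
qed

lemma bond_weight_encode: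
  assumes "(l, r, a) \<in> configs k N"
  shows "bond_weight G N x (left_bits k N (encode k N l r a)) (right_bits k N (encode k N l r a)) = bond_weight G N x l r"
proof (rule bond_weight_cong)
  have l: "l \<in> {1..N} \<rightarrow>\<^sub>E bitvecs k" and r: "r \<in> {1..<N} \<rightarrow>\<^sub>E bitvecs k" and a: "a \<in> {1..N} \<rightarrow>\<^sub>E bitvecs (k - 1)"
    using assms by auto
  have mem: "\<And>j. 1 \<le> j \<Longrightarrow> j \<le> N \<Longrightarrow> l j \<in> bitvecs k" "\<And>j. 1 \<le> j \<Longrightarrow> j < N \<Longrightarrow> r j \<in> bitvecs k"
      "\<And>j. 1 \<le> j \<Longrightarrow> j \<le> N \<Longrightarrow> a j \<in> bitvecs (k - 1)"
    using PiE_mem[OF l] PiE_mem[OF r] PiE_mem[OF a] by auto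
  show "left_bits k N (encode k N l r a) j = l j" if "1 \<le> j" "j \<le> N" for j
    by (rule left_bits_encode[OF mem that])
  show "right_bits k N (encode k N l r a) j = r j" if "1 \<le> j" "j < N" for j
    by (rule right_bits_encode[OF mem that])
qed

text \<open>The function \<open>w\<close> covers both amplitudes and squared moduli. Vertical values
  do not enter the bond weight, so their sum can be taken first.\<close>

lemma sum_bond_state:
  fixes w :: "complex \<Rightarrow> 'a::comm_semiring_0" and F :: "gidx \<Rightarrow> 'a"
  assumes "w 0 = 0"
  shows "(\<Sum>b\<in>gbasis k N (d0 k N). F b * w (bond_state k N x G b))
    = (\<Sum>l\<in>{1..N} \<rightarrow>\<^sub>E bitvecs k. \<Sum>r\<in>{1..<N} \<rightarrow>\<^sub>E bitvecs k. (\<Sum>a\<in>{1..N} \<rightarrow>\<^sub>E bitvecs (k - 1). F (encode k N l r a)) * w (bond_weight G N x l r))"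
proof -
  have "(\<Sum>b\<in>gbasis k N (d0 k N). F b * w (bond_state k N x G b))
    = (\<Sum>b | b \<in> gbasis k N (d0 k N) \<and> vertical_match k N b. F b * w (bond_weight G N x (left_bits k N b) (right_bits k N b)))"
    by (rule sum.mono_neutral_cong_right) (auto simp: bond_state_def assms)
  also have "\<dots> = (\<Sum>(l, r, a)\<in>configs k N. F (encode k N l r a) * w (bond_weight G N x l r))"
    unfolding sum_vertical_match by (rule sum.cong[OF refl]) (auto simp: bond_weight_encode simp del: One_nat_def)
  also have "\<dots> = (\<Sum>l\<in>{1..N} \<rightarrow>\<^sub>E bitvecs k. \<Sum>r\<in>{1..<N} \<rightarrow>\<^sub>E bitvecs k. \<Sum>a\<in>{1..N} \<rightarrow>\<^sub>E bitvecs (k - 1). F (encode k N l r a) * w (bond_weight G N x l r))"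
    by (simp only: sum.cartesian_product[symmetric] case_prod_conv split_beta)
  finally show ?thesis by (simp only: sum_distrib_right)
qed

text \<open>Distributing the sum over vertical values through the product of columns yields the
  column matrices; the sum over left and right bits is then a path sum.\<close>

lemma kraus_bond_state:
  assumes "x \<in> bitvecs k" "y \<in> bitvecs k" "N \<ge> 1"
  shows "(\<Sum>b\<in>gbasis k N (d0 k N). prod_kraus k N B y b * bond_state k N x G b) = chain k (column k N B) G N y x"
proof -
  have "(\<Sum>a\<in>{1..N} \<rightarrow>\<^sub>E bitvecs (k - 1). prod_kraus k N B y (encode k N l r a))
    = (\<Prod>j\<in>{1..N}. column k N B j (if j = N then y else r j) (l j))" for l r
  proof -
    have *: "(if j = N then y i else r j i) = (if j = N then y else r j) i" for j i by simp
    show ?thesis unfolding prod_kraus_encode * column_def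
      by (subst prod_sum_PiE) auto
  qed
  then show ?thesis
    unfolding sum_bond_state[of "\<lambda>z. z", OF refl]
    using path_sum_endpoint[OF assms] by simp
qed

text \<open>Every choice of vertical values contributes equally, hence the cardinality. What remains
  is a path sum with all-ones columns and squared moduli of \<open>G\<close> on the bonds.\<close>

lemma norm_bond_state:
  assumes "x \<in> bitvecs k" "N \<ge> 1" "G 0 = bvI"
  shows "(\<Sum>b\<in>gbasis k N (d0 k N). (cmod (bond_state k N x G b))\<^sup>2)
    = real (card ({1..N} \<rightarrow>\<^sub>E bitvecs (k - 1))) * (\<Prod>j\<in>{1..<N}. hs2 k (G j))"
proof -
  let ?G = "\<lambda>j u v. complex_of_real ((cmod (G j u v))\<^sup>2)"
  have w: "complex_of_real ((cmod (bond_weight G N x l r))\<^sup>2) = bond_weight ?G N x l r" for l r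
    by (simp only: bond_weight_def prod_norm[symmetric] prod_power_distrib of_real_prod)
  obtain n where n: "N = Suc n" using assms(2) by (cases N) auto
  have G0: "?G 0 = bvI" by (rule ext, rule ext) (simp add: assms bvI_def)
  have "complex_of_real (\<Sum>b\<in>gbasis k N (d0 k N). (cmod (bond_state k N x G b))\<^sup>2)
    = (\<Sum>b\<in>gbasis k N (d0 k N). 1 * complex_of_real ((cmod (bond_state k N x G b))\<^sup>2))"
    by simp
  also have "\<dots> = of_nat (card ({1..N} \<rightarrow>\<^sub>E bitvecs (k - 1))) *
     (\<Sum>l\<in>{1..N} \<rightarrow>\<^sub>E bitvecs k. \<Sum>r\<in>{1..<N} \<rightarrow>\<^sub>E bitvecs k. bond_weight ?G N x l r)"
    by (subst sum_bond_state[of "\<lambda>z. complex_of_real ((cmod z)\<^sup>2)"]) (simp_all only: w sum_constant mult_1_right sum_distrib_left norm_zero zero_power2 of_real_0)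
  also have "(\<Sum>l\<in>{1..N} \<rightarrow>\<^sub>E bitvecs k. \<Sum>r\<in>{1..<N} \<rightarrow>\<^sub>E bitvecs k. bond_weight ?G N x l r)
     = chain k (\<lambda>_ _ _. 1) ?G N x x"
    using path_sum_endpoint[OF assms(1) assms(1) assms(2), of "\<lambda>_ _ _. 1" ?G] by simp
  also have "\<dots> = (\<Prod>j\<in>{1..n}. \<Sum>u\<in>bitvecs k. \<Sum>v\<in>bitvecs k. ?G j u v)"
    unfolding n by (rule chain_ones[where G = ?G, OF assms(1) G0])
  also have "\<dots> = (\<Prod>j\<in>{1..<N}. complex_of_real (hs2 k (G j)))"
    by (simp add: n hs2_def atLeastLessThanSuc_atLeastAtMost)
  also have "of_nat (card ({1..N} \<rightarrow>\<^sub>E bitvecs (k - 1))) * (\<Prod>j\<in>{1..<N}. complex_of_real (hs2 k (G j)))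
     = complex_of_real (real (card ({1..N} \<rightarrow>\<^sub>E bitvecs (k - 1))) * (\<Prod>j\<in>{1..<N}. hs2 k (G j)))"
    by simp
  finally show ?thesis by (simp only: of_real_eq_iff)
qed

section \<open>The initial state as a superposition of bond states\<close>

definition horizontal_match :: "nat \<Rightarrow> nat \<Rightarrow> gidx \<Rightarrow> bool" where
  "horizontal_match k N b \<longleftrightarrow> (\<forall>i j. 1 \<le> i \<and> i \<le> k \<and> 1 \<le> j \<and> j < N \<longrightarrow>
                  pbit k N (i,j) 4 (b (i,j)) = pbit k N (i,j+1) 3 (b (i,j+1)))"

text \<open>A product of entries of \<open>bvI\<close> is the indicator that all bonds agree: on
  bond 0 this fixes the input bits to \<open>x\<close>, on the others it is the EPR
  correlation.\<close>

lemma bond_state_EPR: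
  assumes "N \<ge> 1" "b \<in> gbasis k N (d0 k N)"
  shows "bond_state k N x (\<lambda>_. bvI) b = (if left_bits k N b 1 = x then
    if vertical_match k N b \<and> horizontal_match k N b then 1 else 0 else 0)"
proof -
  have p: "(\<Prod>j\<in>S. if P j then 1 else (0::complex)) = (if \<forall>j\<in>S. P j then 1 else 0)" if "finite S" for S :: "nat set" and P
    using that by induction auto
  have "(\<forall>j\<in>{1..N}. left_bits k N b j = (if j = 1 then x else right_bits k N b (j - 1)))
     \<longleftrightarrow> left_bits k N b 1 = x \<and> (\<forall>j. 1 \<le> j \<and> j < N \<longrightarrow> left_bits k N b (j + 1) = right_bits k N b j)" (is "?l \<longleftrightarrow> ?r")
  proof
    assume l: ?l
    have "left_bits k N b (j + 1) = right_bits k N b j" if "1 \<le> j" "j < N" for j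
      using bspec[OF l, of "j + 1"] that by simp
    then show ?r using bspec[OF l, of 1] assms by simp
  next
    assume r: ?r
    have "left_bits k N b j = right_bits k N b (j - 1)" if "1 \<le> j" "j \<le> N" "j \<noteq> 1" for j
    proof -
      have "left_bits k N b (j - 1 + 1) = right_bits k N b (j - 1)"
        using that by (intro r[THEN conjunct2, rule_format]) auto
      then show ?thesis using that by simp
    qed
    then show ?l using r by simp
  qed
  moreover have "(\<forall>j. 1 \<le> j \<and> j < N \<longrightarrow> left_bits k N b (j + 1) = right_bits k N b j) \<longleftrightarrow> horizontal_match k N b"
    unfolding horizontal_match_def left_bits_def right_bits_def fun_eq_iff by auto
  ultimately show ?thesis
    using assms(2) unfolding bond_state_def bond_weight_def bvI_def by (simp add: p del: One_nat_def)
qed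

lemma init_amp_bond_state:
  assumes "N \<ge> 1" "b \<in> gbasis k N (d0 k N)"
  shows "init_amp k N \<psi> b = complex_of_real ((1 / sqrt 2) ^ nedges k N) * (\<Sum>x\<in>bitvecs k. \<psi> x * bond_state k N x (\<lambda>_. bvI) b)"
proof -
  have "(\<Sum>x\<in>bitvecs k. \<psi> x * bond_state k N x (\<lambda>_. bvI) b)
    = (\<Sum>x\<in>bitvecs k. if left_bits k N b 1 = x then \<psi> x * (if vertical_match k N b \<and> horizontal_match k N b then 1 else 0) else 0)"
    unfolding bond_state_EPR[OF assms] by (intro sum.cong refl) auto
  also have "\<dots> = \<psi> (left_bits k N b 1) * (if vertical_match k N b \<and> horizontal_match k N b then 1 else 0)"
    by (simp add: left_bits_bitvec)
  finally show ?thesis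
    using assms(2) unfolding init_amp_def vertical_match_def horizontal_match_def left_bits_def by simp
qed

section \<open>Deterministic branches\<close>

lemma product_form_pure:
  assumes "product_form k N d \<Phi> Bs" "y \<in> bitvecs k" "y' \<in> bitvecs k"
  shows "\<Phi> (\<lambda>b c. \<chi> b * cnj (\<chi> c)) y y' = (\<Sum>B\<leftarrow>Bs.
    (\<Sum>b\<in>gbasis k N d. prod_kraus k N B y b * \<chi> b) * cnj (\<Sum>b\<in>gbasis k N d. prod_kraus k N B y' b * \<chi> b))"
proof -
  have "\<Phi> (\<lambda>b c. \<chi> b * cnj (\<chi> c)) y y' = (\<Sum>B\<leftarrow>Bs. \<Sum>b\<in>gbasis k N d. \<Sum>c\<in>gbasis k N d.
        prod_kraus k N B y b * (\<chi> b * cnj (\<chi> c)) * cnj (prod_kraus k N B y' c))"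
    using assms unfolding product_form_def by blast
  also have "\<dots> = (\<Sum>B\<leftarrow>Bs.
    (\<Sum>b\<in>gbasis k N d. prod_kraus k N B y b * \<chi> b) * cnj (\<Sum>b\<in>gbasis k N d. prod_kraus k N B y' b * \<chi> b))"
    by (simp add: sum_product mult_ac)
  finally show ?thesis .
qed

lemma of_real_sum_list: "of_real (\<Sum>x\<leftarrow>xs. f x) = (\<Sum>x\<leftarrow>xs. of_real (f x))"
  by (induction xs) auto

text \<open>Trace preservation for a bond state: the branch outputs together carry the squared norm
  of the input. The bond matrices are free, so the protocol is tested on more than its own resource
  state.\<close>

lemma sum_list_chain:
  assumes "locc_out k N (d0 k N) \<Phi>" "product_form k N (d0 k N) \<Phi> Bs" "x \<in> bitvecs k" "N \<ge> 1" "G 0 = bvI"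
  shows "(\<Sum>B\<leftarrow>Bs. \<Sum>y\<in>bitvecs k. (cmod (chain k (column k N B) G N y x))\<^sup>2)
    = real (card ({1..N} \<rightarrow>\<^sub>E bitvecs (k - 1))) * (\<Prod>j\<in>{1..<N}. hs2 k (G j))"
proof -
  let ?\<chi> = "bond_state k N x G" and ?Q = "\<lambda>B. chain k (column k N B) G N"
  have "complex_of_real (\<Sum>B\<leftarrow>Bs. \<Sum>y\<in>bitvecs k. (cmod (?Q B y x))\<^sup>2)
     = (\<Sum>y\<in>bitvecs k. \<Sum>B\<leftarrow>Bs. ?Q B y x * cnj (?Q B y x))"
    by (simp only: of_real_sum_list of_real_sum complex_norm_square sum_list_sum_swap)
  also have "\<dots> = (\<Sum>y\<in>bitvecs k. \<Phi> (\<lambda>b c. ?\<chi> b * cnj (?\<chi> c)) y y)"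
    by (intro sum.cong refl) (simp add: product_form_pure[OF assms(2)] kraus_bond_state assms(3,4) del: cnj_sum One_nat_def)
  also have "\<dots> = (\<Sum>b\<in>gbasis k N (d0 k N). ?\<chi> b * cnj (?\<chi> b))"
    by (rule locc_out_trace[OF assms(1)])
  also have "\<dots> = complex_of_real (\<Sum>b\<in>gbasis k N (d0 k N). (cmod (?\<chi> b))\<^sup>2)"
    by (simp only: of_real_sum complex_norm_square)
  finally show ?thesis
    unfolding norm_bond_state[of x k N G, OF assms(3-5)] by (simp only: of_real_eq_iff)
qed

lemma sum_list_norm_eq_0:
  assumes "(\<Sum>x\<leftarrow>xs. f x * cnj (f x)) = 0" "x \<in> set xs"
  shows "f x = (0 :: complex)"
proof -
  have "complex_of_real (\<Sum>x\<leftarrow>xs. (cmod (f x))\<^sup>2) = 0"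
    using assms(1) by (simp only: of_real_sum_list complex_norm_square)
  then have "(\<Sum>x\<leftarrow>xs. (cmod (f x))\<^sup>2) = 0" by (simp only: of_real_eq_0_iff)
  then have "\<forall>a\<in>set (map (\<lambda>x. (cmod (f x))\<^sup>2) xs). a = 0"
    by (subst (asm) sum_list_nonneg_eq_0_iff) auto
  then show ?thesis using assms(2) by simp
qed

lemma apply_U_cong: "eq_bv k A B \<Longrightarrow> y \<in> bitvecs k \<Longrightarrow> apply_U k A \<psi> y = apply_U k B \<psi> y"
  by (simp add: apply_U_def eq_bv_def)

lemma apply_U_mult: "apply_U k (bv_mult k A B) \<psi> = apply_U k A (apply_U k B \<psi>)"
  by (rule ext) (simp add: apply_U_def bv_mult_def sum_distrib_left sum_distrib_right mult.assoc, rule sum.swap)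

lemma apply_U_I: "y \<in> bitvecs k \<Longrightarrow> apply_U k bvI \<psi> y = \<psi> y"
proof -
  assume "y \<in> bitvecs k"
  moreover have "apply_U k bvI \<psi> y = (\<Sum>x\<in>bitvecs k. if y = x then \<psi> x else 0)"
    unfolding apply_U_def bvI_def by (rule sum.cong) auto
  ultimately show ?thesis by simp
qed

text \<open>Testing on basis vectors makes each \<open>P B\<close> diagonal; testing on \<open>(e\<^sub>w + e\<^sub>u) / \<surd>2\<close> makes the diagonal constant.\<close>

lemma identity_channel_kraus_scalar:
  assumes id: "\<And>\<psi> z z'. (\<Sum>x\<in>bitvecs k. (cmod (\<psi> x))\<^sup>2) = 1 \<Longrightarrow> z \<in> bitvecs k \<Longrightarrow> z' \<in> bitvecs k \<Longrightarrow>
      (\<Sum>B\<leftarrow>Bs. apply_U k (P B) \<psi> z * cnj (apply_U k (P B) \<psi> z')) = \<psi> z * cnj (\<psi> z')"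
    and B: "B \<in> set Bs"
  shows "\<exists>c. eq_bv k (P B) (\<lambda>y x. c * bvI y x)"
proof -
  let ?B = "bitvecs k"
  have basis: "(\<Sum>B\<leftarrow>Bs. P B z w * cnj (P B z' w)) = (if z = w \<and> z' = w then 1 else 0)"
    if "w \<in> ?B" "z \<in> ?B" "z' \<in> ?B" for w z z'
  proof -
    let ?\<psi> = "\<lambda>x. if x = w then 1 else (0::complex)"
    have "(\<Sum>x\<in>?B. (cmod (?\<psi> x))\<^sup>2) = (\<Sum>x\<in>?B. if x = w then 1 else 0)"
      by (rule sum.cong) auto
    then have "(\<Sum>x\<in>?B. (cmod (?\<psi> x))\<^sup>2) = 1" using that by simp
    moreover have "apply_U k A ?\<psi> u = A u w" for A u
    proof -
      have "apply_U k A ?\<psi> u = (\<Sum>x\<in>?B. if x = w then A u x else 0)"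
        unfolding apply_U_def by (rule sum.cong) auto
      then show ?thesis using that by simp
    qed
    ultimately show ?thesis using id[of ?\<psi> z z'] that by auto
  qed
  have diag: "P B z w = 0" if "B \<in> set Bs" "z \<in> ?B" "w \<in> ?B" "z \<noteq> w" for B z w
    using basis[of w z z] that by (intro sum_list_norm_eq_0[of "\<lambda>B. P B z w"]) auto
  have const: "P B w w = P B u u" if w: "w \<in> ?B" and u: "u \<in> ?B" and wu: "w \<noteq> u" for w u
  proof -
    let ?\<psi> = "\<lambda>x. if x = w \<or> x = u then complex_of_real (1 / sqrt 2) else 0"
    have "(\<Sum>x\<in>?B. (cmod (?\<psi> x))\<^sup>2) = (\<Sum>x\<in>?B. (if x = w then 1/2 else 0) + (if x = u then 1/2 else 0))"
      using wu by (intro sum.cong) (auto simp: power_divide norm_divide)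
    also have "\<dots> = 1" using w u by (simp add: sum.distrib)
    finally have norm: "(\<Sum>x\<in>?B. (cmod (?\<psi> x))\<^sup>2) = 1" .
    have app: "apply_U k (P B) ?\<psi> v = complex_of_real (1 / sqrt 2) * P B v v" if B: "B \<in> set Bs" and v: "v = w \<or> v = u" for B v
    proof -
      have "v \<in> ?B" using v w u by auto
      have "apply_U k (P B) ?\<psi> v = (\<Sum>x\<in>?B. if x = v then complex_of_real (1 / sqrt 2) * P B v v else 0)"
        unfolding apply_U_def using v diag[OF B \<open>v \<in> ?B\<close>] by (intro sum.cong refl) auto
      then show ?thesis using \<open>v \<in> ?B\<close> by simp
    qed
    have half: "complex_of_real (1 / sqrt 2) * cnj (complex_of_real (1 / sqrt 2)) = 1 / 2"
    proof -
      have "(1 / sqrt 2) * (1 / sqrt 2) = 1 / 2" by (simp add: field_simps)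
      then show ?thesis by (metis complex_cnj_complex_of_real of_real_mult of_real_divide of_real_1 of_real_numeral)
    qed
    have cross: "(\<Sum>B\<leftarrow>Bs. P B v v * cnj (P B v' v')) = 1" if v: "v = w \<or> v = u" "v' = w \<or> v' = u" for v v'
    proof -
      have "1 / 2 = (\<Sum>B\<leftarrow>Bs. apply_U k (P B) ?\<psi> v * cnj (apply_U k (P B) ?\<psi> v'))"
        using id[OF norm, of v v'] v w u half by auto
      also have "\<dots> = (\<Sum>B\<leftarrow>Bs. (complex_of_real (1 / sqrt 2) * cnj (complex_of_real (1 / sqrt 2))) * (P B v v * cnj (P B v' v')))"
        by (intro arg_cong[where f = sum_list] map_cong refl) (simp only: app v complex_cnj_mult mult_ac)
      also have "\<dots> = 1 / 2 * (\<Sum>B\<leftarrow>Bs. P B v v * cnj (P B v' v'))"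
        unfolding half by (rule sum_list_const_mult)
      finally show ?thesis by simp
    qed
    \<comment> \<open>All four sums on the right equal 1, so the squared moduli of the differences
      sum to 1 - 1 - 1 + 1 = 0.\<close>
    have "(\<Sum>B\<leftarrow>Bs. (P B w w - P B u u) * cnj (P B w w - P B u u))
      = (\<Sum>B\<leftarrow>Bs. P B w w * cnj (P B w w)) - (\<Sum>B\<leftarrow>Bs. P B w w * cnj (P B u u))
        - (\<Sum>B\<leftarrow>Bs. P B u u * cnj (P B w w)) + (\<Sum>B\<leftarrow>Bs. P B u u * cnj (P B u u))"
      by (simp add: algebra_simps sum_list_addf sum_list_subtractf)
    then have "(\<Sum>B\<leftarrow>Bs. (P B w w - P B u u) * cnj (P B w w - P B u u)) = 0"
      using cross[of w w] cross[of w u] cross[of u w] cross[of u u] by (simp del: complex_cnj_diff)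
    from sum_list_norm_eq_0[OF this B] show ?thesis by simp
  qed
  define c where "c = P B (\<lambda>_. 0) (\<lambda>_. 0)"
  have "P B w w = c" if "w \<in> ?B" for w
    unfolding c_def using const[OF that zero_in_bitvecs] by (cases "w = (\<lambda>_. 0)") auto
  then have "eq_bv k (P B) (\<lambda>y x. c * bvI y x)"
    using diag[OF B] by (auto simp: eq_bv_def bvI_def)
  then show ?thesis ..
qed

text \<open>Applying the adjoint of \<open>U\<close> after every branch turns the channel into the
  identity channel, whose branches are scalar; multiplying back by \<open>U\<close> gives the
  claim.\<close>

lemma kraus_scalar_unitary:
  assumes U: "unitary_bv k U"
    and id: "\<And>\<psi> z z'. (\<Sum>x\<in>bitvecs k. (cmod (\<psi> x))\<^sup>2) = 1 \<Longrightarrow> z \<in> bitvecs k \<Longrightarrow> z' \<in> bitvecs k \<Longrightarrow>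
      (\<Sum>B\<leftarrow>Bs. apply_U k (Q B) \<psi> z * cnj (apply_U k (Q B) \<psi> z')) = apply_U k U \<psi> z * cnj (apply_U k U \<psi> z')"
    and B: "B \<in> set Bs"
  shows "\<exists>c. eq_bv k (Q B) (\<lambda>y x. c * U y x)"
proof -
  let ?B = "bitvecs k"
  let ?P = "\<lambda>B. bv_mult k (adj U) (Q B)"
  have "\<exists>c. eq_bv k (?P B) (\<lambda>y x. c * bvI y x)"
  proof (rule identity_channel_kraus_scalar[OF _ B])
    fix \<psi> :: "bv \<Rightarrow> complex" and z z'
    assume \<psi>: "(\<Sum>x\<in>?B. (cmod (\<psi> x))\<^sup>2) = 1" and z: "z \<in> ?B" "z' \<in> ?B"
    have expand: "apply_U k (bv_mult k (adj U) A) \<psi> z * cnj (apply_U k (bv_mult k (adj U) A) \<psi> z')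
       = (\<Sum>y\<in>?B. \<Sum>y'\<in>?B. adj U z y * cnj (adj U z' y') * (apply_U k A \<psi> y * cnj (apply_U k A \<psi> y')))" for A
      unfolding apply_U_mult apply_U_def[of k "adj U"] by (simp add: sum_product mult_ac)
    have "(\<Sum>B\<leftarrow>Bs. apply_U k (?P B) \<psi> z * cnj (apply_U k (?P B) \<psi> z'))
      = (\<Sum>y\<in>?B. \<Sum>y'\<in>?B. adj U z y * cnj (adj U z' y') * (\<Sum>B\<leftarrow>Bs. apply_U k (Q B) \<psi> y * cnj (apply_U k (Q B) \<psi> y')))"
      unfolding expand sum_list_sum_swap sum_list_const_mult ..
    also have "\<dots> = apply_U k (bv_mult k (adj U) U) \<psi> z * cnj (apply_U k (bv_mult k (adj U) U) \<psi> z')"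
      unfolding expand by (intro sum.cong refl) (simp add: id[OF \<psi>])
    also have "\<dots> = \<psi> z * cnj (\<psi> z')"
      using U z apply_U_cong[of k "bv_mult k (adj U) U" bvI] by (simp add: unitary_bv_iff apply_U_I)
    finally show "(\<Sum>B\<leftarrow>Bs. apply_U k (?P B) \<psi> z * cnj (apply_U k (?P B) \<psi> z')) = \<psi> z * cnj (\<psi> z')" .
  qed
  then obtain c where c: "eq_bv k (?P B) (\<lambda>y x. c * bvI y x)" ..
  have UU: "eq_bv k bvI (bv_mult k U (adj U))" using U by (simp add: unitary_bv_iff eq_bv_sym)
  have "eq_bv k (Q B) (bv_mult k bvI (Q B))" by (rule eq_bv_sym[OF bv_mult_I_left])
  also have "eq_bv k \<dots> (bv_mult k (bv_mult k U (adj U)) (Q B))" by (rule bv_mult_cong[OF UU eq_bv_refl])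
  also have "\<dots> = bv_mult k U (?P B)" by (rule bv_mult_assoc[symmetric])
  also have "eq_bv k \<dots> (bv_mult k U (\<lambda>y x. c * bvI y x))" by (rule bv_mult_cong[OF eq_bv_refl c])
  also have "\<dots> = (\<lambda>y x. c * bv_mult k U bvI y x)"
    by (intro ext) (simp add: bv_mult_def sum_distrib_left mult_ac)
  also have "eq_bv k \<dots> (\<lambda>y x. c * U y x)"
    using bv_mult_I_right[of k U] by (simp add: eq_bv_def)
  finally show ?thesis ..
qed

section \<open>Cuts between columns\<close>

lemma chain_cong:
  assumes "\<And>j. j < n \<Longrightarrow> M (Suc j) = M' (Suc j)" "\<And>j. j < n \<Longrightarrow> G j = G' j"
  shows "chain k M G n = chain k M' G' n"
  using assms by (induction n) auto

text \<open>The bond at the cut \<open>s\<close> goes with the later columns, where it becomes bond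
  0.\<close>

lemma chain_split:
  "eq_bv k (chain k M G (s + t)) (bv_mult k (chain k (\<lambda>j. M (s + j)) (\<lambda>j. G (s + j)) t) (chain k M G s))"
proof (induction t)
  case 0
  show ?case by (simp add: eq_bv_sym[OF bv_mult_I_left])
next
  case (Suc t)
  show ?case
    using bv_mult_cong[OF eq_bv_refl Suc, of "bv_mult k (M (Suc (s + t))) (G (s + t))"]
    by (simp add: bv_mult_assoc)
qed

text \<open>Detaches bond 0, the rightmost factor; together with \<open>chain_split\<close> this
  isolates the bond at a cut.\<close>

lemma chain_head:
  "eq_bv k (chain k M G (Suc t)) (bv_mult k (chain k M (G(0 := bvI)) (Suc t)) (G 0))"
proof (induction t)
  case 0
  have "eq_bv k (chain k M G (Suc 0)) (bv_mult k (M (Suc 0)) (G 0))"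
    unfolding chain.simps by (rule bv_mult_I_right)
  moreover have "eq_bv k (bv_mult k (chain k M (G(0 := bvI)) (Suc 0)) (G 0)) (bv_mult k (M (Suc 0)) (G 0))"
  proof (rule bv_mult_cong[OF _ eq_bv_refl])
    have "eq_bv k (chain k M (G(0 := bvI)) (Suc 0)) (bv_mult k (M (Suc 0)) bvI)"
      unfolding chain.simps fun_upd_same by (rule bv_mult_I_right)
    also have "eq_bv k \<dots> (M (Suc 0))" by (rule bv_mult_I_right)
    finally show "eq_bv k (chain k M (G(0 := bvI)) (Suc 0)) (M (Suc 0))" .
  qed
  ultimately show ?case using eq_bv_sym eq_bv_trans by blast
next
  case (Suc t)
  show ?case
    using bv_mult_cong[OF eq_bv_refl Suc, of "bv_mult k (M (Suc (Suc t))) (G (Suc t))"]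
    by (subst (1 2) chain.simps(2)) (simp only: bv_mult_assoc fun_upd_other nat.distinct simp_thms)
qed

definition matrix_unit :: "bv \<Rightarrow> bv \<Rightarrow> bv \<Rightarrow> bv \<Rightarrow> complex" where
  "matrix_unit u v = (\<lambda>y x. if y = u \<and> x = v then 1 else 0)"

lemma bv_mult_matrix_unit:
  assumes "u \<in> bitvecs k" "v \<in> bitvecs k"
  shows "bv_mult k (bv_mult k A (matrix_unit u v)) C y x = A y u * C v x"
proof -
  have 1: "bv_mult k A (matrix_unit u v) y z = (if z = v then A y u else 0)" for z
  proof -
    have "bv_mult k A (matrix_unit u v) y z = (\<Sum>w\<in>bitvecs k. if w = u then if z = v then A y w else 0 else 0)"
      unfolding bv_mult_def matrix_unit_def by (rule sum.cong) auto
    then show ?thesis using assms by simp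
  qed
  have "bv_mult k (bv_mult k A (matrix_unit u v)) C y x = (\<Sum>z\<in>bitvecs k. if z = v then A y u * C z x else 0)"
    unfolding bv_mult_def[of k "bv_mult k A _"] 1 by (rule sum.cong) auto
  then show ?thesis using assms by simp
qed

lemma hs2_matrix_unit:
  assumes "u \<in> bitvecs k" "v \<in> bitvecs k"
  shows "hs2 k (matrix_unit u v) = 1"
proof -
  have "hs2 k (matrix_unit u v) = (\<Sum>y\<in>bitvecs k. \<Sum>x\<in>bitvecs k. if x = v then if y = u then 1 else 0 else 0)"
    unfolding hs2_def matrix_unit_def by (intro sum.cong refl) auto
  also have "\<dots> = 1" using assms by simp
  finally show ?thesis .
qed

lemma hs2_bvI: "hs2 k bvI = real (card (bitvecs k))"
proof -
  have "hs2 k bvI = (\<Sum>y\<in>bitvecs k. \<Sum>x\<in>bitvecs k. if y = x then 1 else 0)"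
    unfolding hs2_def bvI_def by (intro sum.cong refl) auto
  then show ?thesis by simp
qed

abbreviation columns :: "nat \<Rightarrow> (nat \<Rightarrow> bv \<Rightarrow> bv \<Rightarrow> complex) \<Rightarrow> nat \<Rightarrow> bv \<Rightarrow> bv \<Rightarrow> complex" where
  "columns k M \<equiv> chain k M (\<lambda>_. bvI)"

lemma columns_split:
  "eq_bv k (columns k M (s + t)) (bv_mult k (columns k (\<lambda>j. M (s + j)) t) (columns k M s))"
  by (rule chain_split)

text \<open>A matrix unit has rank one, so inserting it on bond \<open>s\<close> disconnects the
  network: the amplitude splits into an entry of the later columns times an entry of the earlier
  ones.\<close>

lemma chain_cut:
  assumes "s < N" "u \<in> bitvecs k" "v \<in> bitvecs k" "y \<in> bitvecs k" "x \<in> bitvecs k"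
  shows "chain k M ((\<lambda>_. bvI)(s := matrix_unit u v)) N y x
    = columns k (\<lambda>j. M (s + j)) (N - s) y u * columns k M s v x"
proof -
  let ?G = "(\<lambda>_. bvI)(s := matrix_unit u v)"
  obtain t where t: "N = s + Suc t" using assms(1) less_imp_Suc_add by auto
  have G: "(\<lambda>j. ?G (s + j))(0 := bvI) = (\<lambda>_. bvI)" by auto
  have "eq_bv k (chain k M ?G N) (bv_mult k (chain k (\<lambda>j. M (s + j)) (\<lambda>j. ?G (s + j)) (Suc t)) (chain k M ?G s))"
    unfolding t by (rule chain_split)
  also have "chain k M ?G s = columns k M s" by (rule chain_cong) auto
  also have "eq_bv k (bv_mult k (chain k (\<lambda>j. M (s + j)) (\<lambda>j. ?G (s + j)) (Suc t)) (columns k M s))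
     (bv_mult k (bv_mult k (columns k (\<lambda>j. M (s + j)) (Suc t)) (matrix_unit u v)) (columns k M s))"
    using chain_head[of k "\<lambda>j. M (s + j)" "\<lambda>j. ?G (s + j)" t]
    unfolding G by (intro bv_mult_cong eq_bv_refl) simp
  finally have "chain k M ?G N y x
      = bv_mult k (bv_mult k (columns k (\<lambda>j. M (s + j)) (Suc t)) (matrix_unit u v)) (columns k M s) y x"
    using assms(4,5) unfolding eq_bv_def by blast
  also have "\<dots> = columns k (\<lambda>j. M (s + j)) (Suc t) y u * columns k M s v x"
    by (rule bv_mult_matrix_unit[OF assms(2,3)])
  also have "Suc t = N - s" using t by simp
  finally show ?thesis .
qed

text \<open>Summing the trace preservation identity over all matrix units inserted at the cut \<open>s\<close> and comparing with
  the uncut network forces equality in Cauchy--Schwarz for every branch.\<close>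

lemma columns_prefix_unitary:
  assumes locc: "locc_out k N (d0 k N) \<Phi>" and Bs: "product_form k N (d0 k N) \<Phi> Bs" and U: "unitary_bv k U"
    and c: "\<And>B. B \<in> set Bs \<Longrightarrow> eq_bv k (columns k (column k N B) N) (\<lambda>y x. c B * U y x)"
    and s: "1 \<le> s" "s < N" and B: "B \<in> set Bs" "c B \<noteq> 0"
  shows "\<exists>\<gamma>. \<gamma> \<noteq> 0 \<and> unitary_bv k (\<lambda>y x. columns k (column k N B) s y x / \<gamma>)"
proof -
  let ?B = "bitvecs k" and ?C = "real (card ({1..N} \<rightarrow>\<^sub>E bitvecs (k - 1)))"
  define D where "D = real (card ?B)"
  let ?W = "\<lambda>B. columns k (\<lambda>j. column k N B (s + j)) (N - s)" and ?L = "\<lambda>B. columns k (column k N B) s"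
  have N: "N \<ge> 1" using s by simp
  have WL: "eq_bv k (bv_mult k (?W B) (?L B)) (\<lambda>y x. c B * U y x)" if "B \<in> set Bs" for B
    using eq_bv_trans[OF eq_bv_sym[OF columns_split[of k "column k N B" s "N - s"]]] c[OF that] s by simp
  have colU: "(\<Sum>y\<in>?B. (cmod (U y x))\<^sup>2) = 1" if "x \<in> ?B" for x
  proof -
    have "complex_of_real (\<Sum>y\<in>?B. (cmod (U y x))\<^sup>2) = (\<Sum>y\<in>?B. cnj (U y x) * U y x)"
      by (simp only: of_real_sum complex_norm_square mult.commute)
    also have "\<dots> = 1" using U that by (simp add: unitary_bv_def)
    finally show ?thesis by (simp only: of_real_eq_1_iff)
  qed
  \<comment> \<open>Trace preservation with identity bonds and the zero basis vector as input: each
    of the \<open>N - 1\<close> bonds has squared norm \<open>D\<close>, and the columns of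
    \<open>U\<close> are unit vectors.\<close>
  have uncut: "(\<Sum>B\<leftarrow>Bs. (cmod (c B))\<^sup>2) = ?C * D ^ (N - 1)"
  proof -
    have "(\<Sum>B\<leftarrow>Bs. (cmod (c B))\<^sup>2) = (\<Sum>B\<leftarrow>Bs. \<Sum>y\<in>?B. (cmod (columns k (column k N B) N y (\<lambda>_. 0)))\<^sup>2)"
    proof (intro arg_cong[where f = sum_list] map_cong refl)
      fix B assume "B \<in> set Bs"
      then have "(\<Sum>y\<in>?B. (cmod (columns k (column k N B) N y (\<lambda>_. 0)))\<^sup>2) = (\<Sum>y\<in>?B. (cmod (c B))\<^sup>2 * (cmod (U y (\<lambda>_. 0)))\<^sup>2)"
        using c zero_in_bitvecs by (intro sum.cong refl) (simp add: eq_bv_def norm_mult power_mult_distrib)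
      also have "\<dots> = (cmod (c B))\<^sup>2" using colU[OF zero_in_bitvecs] by (simp add: sum_distrib_left[symmetric])
      finally show "(cmod (c B))\<^sup>2 = (\<Sum>y\<in>?B. (cmod (columns k (column k N B) N y (\<lambda>_. 0)))\<^sup>2)" ..
    qed
    also have "\<dots> = ?C * (\<Prod>j\<in>{1..<N}. hs2 k bvI)"
      by (rule sum_list_chain[where G = "\<lambda>_. bvI", OF locc Bs zero_in_bitvecs N refl])
    finally show ?thesis by (simp add: hs2_bvI D_def)
  qed
  \<comment> \<open>The indices \<open>x\<close>, \<open>u\<close>, \<open>v\<close> give
    \<open>D ^ 3\<close> experiments, in each of which the cut bond has squared norm 1 instead of
    \<open>D\<close>. Summed over them, the split amplitudes give the product of the two squared
    norms.\<close>
  have cut: "(\<Sum>B\<leftarrow>Bs. hs2 k (?W B) * hs2 k (?L B)) = D ^ 2 * (?C * D ^ (N - 1))"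
  proof -
    have "(\<Sum>B\<leftarrow>Bs. hs2 k (?W B) * hs2 k (?L B)) = (\<Sum>B\<leftarrow>Bs. \<Sum>x\<in>?B. \<Sum>u\<in>?B. \<Sum>v\<in>?B. \<Sum>y\<in>?B.
        (cmod (chain k (column k N B) ((\<lambda>_. bvI)(s := matrix_unit u v)) N y x))\<^sup>2)"
    proof (intro arg_cong[where f = sum_list] map_cong refl)
      fix B
      let ?w = "\<lambda>y u. (cmod (?W B y u))\<^sup>2" and ?l = "\<lambda>v x. (cmod (?L B v x))\<^sup>2"
      have "(\<Sum>x\<in>?B. \<Sum>u\<in>?B. \<Sum>v\<in>?B. \<Sum>y\<in>?B. (cmod (chain k (column k N B) ((\<lambda>_. bvI)(s := matrix_unit u v)) N y x))\<^sup>2)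
        = (\<Sum>x\<in>?B. \<Sum>u\<in>?B. \<Sum>v\<in>?B. \<Sum>y\<in>?B. ?w y u * ?l v x)"
        using s by (intro sum.cong refl) (simp add: chain_cut norm_mult power_mult_distrib)
      also have "\<dots> = (\<Sum>x\<in>?B. \<Sum>v\<in>?B. \<Sum>u\<in>?B. \<Sum>y\<in>?B. ?w y u * ?l v x)"
        by (rule sum.cong[OF refl], rule sum.swap)
      also have "\<dots> = (\<Sum>u\<in>?B. \<Sum>y\<in>?B. ?w y u) * (\<Sum>x\<in>?B. \<Sum>v\<in>?B. ?l v x)"
        by (simp add: sum_distrib_left sum_distrib_right)
      also have "\<dots> = hs2 k (?W B) * hs2 k (?L B)"
        unfolding hs2_def by (intro arg_cong2[where f = "(*)"] sum.swap)
      finally show "hs2 k (?W B) * hs2 k (?L B) = (\<Sum>x\<in>?B. \<Sum>u\<in>?B. \<Sum>v\<in>?B. \<Sum>y\<in>?B.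
        (cmod (chain k (column k N B) ((\<lambda>_. bvI)(s := matrix_unit u v)) N y x))\<^sup>2)" ..
    qed
    also have "\<dots> = (\<Sum>x\<in>?B. \<Sum>u\<in>?B. \<Sum>v\<in>?B. ?C * D ^ (N - 2))"
      unfolding sum_list_sum_swap[of _ ?B]
    proof (intro sum.cong refl)
      fix x u v assume xuv: "x \<in> ?B" "u \<in> ?B" "v \<in> ?B"
      let ?G = "(\<lambda>_. bvI)(s := matrix_unit u v)"
      have "(\<Sum>y\<in>?B. \<Sum>B\<leftarrow>Bs. (cmod (chain k (column k N B) ?G N y x))\<^sup>2)
        = (\<Sum>B\<leftarrow>Bs. \<Sum>y\<in>?B. (cmod (chain k (column k N B) ?G N y x))\<^sup>2)"
        by (rule sum_list_sum_swap[symmetric])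
      also have "\<dots> = ?C * (\<Prod>j\<in>{1..<N}. hs2 k (?G j))"
        using s by (intro sum_list_chain[OF locc Bs xuv(1) N]) simp
      also have "(\<Prod>j\<in>{1..<N}. hs2 k (?G j)) = hs2 k (?G s) * (\<Prod>j\<in>{1..<N} - {s}. hs2 k (?G j))"
        using s by (intro prod.remove) auto
      also have "(\<Prod>j\<in>{1..<N} - {s}. hs2 k (?G j)) = (\<Prod>j\<in>{1..<N} - {s}. D)"
        by (intro prod.cong) (auto simp: hs2_bvI D_def)
      also have "\<dots> = D ^ (N - 2)" using s by (simp add: numeral_2_eq_2)
      finally show "(\<Sum>y\<in>?B. \<Sum>B\<leftarrow>Bs. (cmod (chain k (column k N B) ?G N y x))\<^sup>2) = ?C * D ^ (N - 2)"
        by (simp only: fun_upd_same hs2_matrix_unit[OF xuv(2,3)] mult_1_left)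
    qed
    also have "\<dots> = D ^ 3 * (?C * D ^ (N - 2))" by (simp add: D_def power3_eq_cube)
    also have "N - 1 = Suc (N - 2)" using s by simp
    then have "D ^ 3 * (?C * D ^ (N - 2)) = D ^ 2 * (?C * D ^ (N - 1))" by (simp add: power2_eq_square power3_eq_cube)
    finally show ?thesis .
  qed
  \<comment> \<open>By \<open>cut\<close> and \<open>uncut\<close> the Cauchy-Schwarz defects of all
    branches sum to 0; as they are nonnegative, each vanishes.\<close>
  have "(\<Sum>B\<leftarrow>Bs. hs2 k (?W B) * hs2 k (?L B) - (cmod (c B))\<^sup>2 * D\<^sup>2) = 0"
    unfolding sum_list_subtractf sum_list_mult_const cut uncut by simp
  moreover have "0 \<le> hs2 k (?W B) * hs2 k (?L B) - (cmod (c B))\<^sup>2 * D\<^sup>2" if "B \<in> set Bs" for B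
    using hs2_factorisation_le[OF U WL[OF that]] by (simp add: D_def)
  ultimately have "\<forall>a\<in>set (map (\<lambda>B. hs2 k (?W B) * hs2 k (?L B) - (cmod (c B))\<^sup>2 * D\<^sup>2) Bs). a = 0"
    by (subst (asm) sum_list_nonneg_eq_0_iff) auto
  then have "(cmod (c B))\<^sup>2 * D\<^sup>2 = hs2 k (?W B) * hs2 k (?L B)" using B(1) by simp
  then show ?thesis
    using hs2_factorisation_eq[OF U WL[OF B(1)] B(2)] by (simp add: D_def)
qed


text \<open>A single branch of nonzero weight already carries the whole factorisation: its column
  prefixes are unitary up to scalars.\<close>

lemma det_implementable_columns:
  assumes "N \<ge> 1" "unitary_bv k U" "det_implementable k N U"
  shows "\<exists>B \<gamma>. (\<forall>s\<le>N. \<gamma> s \<noteq> 0 \<and> unitary_bv k (\<lambda>y x. columns k (column k N B) s y x / \<gamma> s)) \<and> \<gamma> 0 = 1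
    \<and> eq_bv k (\<lambda>y x. columns k (column k N B) N y x / \<gamma> N) U"
proof -
  obtain \<Phi> where locc: "locc_out k N (d0 k N) \<Phi>"
    and out: "\<And>\<psi> y y'. (\<Sum>x\<in>bitvecs k. (cmod (\<psi> x))\<^sup>2) = 1 \<Longrightarrow> y \<in> bitvecs k \<Longrightarrow> y' \<in> bitvecs k \<Longrightarrow>
       \<Phi> (init_dens k N \<psi>) y y' = apply_U k U \<psi> y * cnj (apply_U k U \<psi> y')"
    using assms(3) unfolding det_implementable_def by blast
  obtain Bs where Bs: "product_form k N (d0 k N) \<Phi> Bs"
    using locc_out_product_form[OF locc assms(1)] by blast
  \<comment> \<open>The normalisation of the EPR pairs, a common nonzero factor that is divided out
    in \<open>c\<close>.\<close>
  define a where "a = complex_of_real ((1 / sqrt 2) ^ nedges k N)"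
  have a: "a \<noteq> 0" by (simp add: a_def)
  let ?Q = "\<lambda>B y x. a * columns k (column k N B) N y x"
  have kraus: "(\<Sum>b\<in>gbasis k N (d0 k N). prod_kraus k N B y b * init_amp k N \<psi> b) = apply_U k (?Q B) \<psi> y"
    if y: "y \<in> bitvecs k" for B y \<psi>
  proof -
    have "(\<Sum>b\<in>gbasis k N (d0 k N). prod_kraus k N B y b * init_amp k N \<psi> b)
      = (\<Sum>b\<in>gbasis k N (d0 k N). \<Sum>x\<in>bitvecs k. a * (prod_kraus k N B y b * bond_state k N x (\<lambda>_. bvI) b) * \<psi> x)"
      by (intro sum.cong refl) (simp only: init_amp_bond_state[OF assms(1)] a_def[symmetric] sum_distrib_left mult_ac)
    also have "\<dots> = (\<Sum>x\<in>bitvecs k. a * (\<Sum>b\<in>gbasis k N (d0 k N). prod_kraus k N B y b * bond_state k N x (\<lambda>_. bvI) b) * \<psi> x)"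
      by (subst sum.swap) (simp only: sum_distrib_left sum_distrib_right)
    also have "\<dots> = apply_U k (?Q B) \<psi> y"
      unfolding apply_U_def by (intro sum.cong refl) (simp add: kraus_bond_state y assms(1) del: One_nat_def)
    finally show ?thesis .
  qed
  have "\<exists>c. eq_bv k (?Q B) (\<lambda>y x. c * U y x)" if B: "B \<in> set Bs" for B
  proof (rule kraus_scalar_unitary[where Bs = Bs, OF assms(2) _ B])
    fix \<psi> :: "bv \<Rightarrow> complex" and z z'
    assume \<psi>: "(\<Sum>x\<in>bitvecs k. (cmod (\<psi> x))\<^sup>2) = 1" and z: "z \<in> bitvecs k" "z' \<in> bitvecs k"
    have "(\<Sum>B\<leftarrow>Bs. apply_U k (?Q B) \<psi> z * cnj (apply_U k (?Q B) \<psi> z')) = \<Phi> (init_dens k N \<psi>) z z'"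
      unfolding init_dens_def product_form_pure[OF Bs z] kraus[OF z(1)] kraus[OF z(2)] ..
    then show "(\<Sum>B\<leftarrow>Bs. apply_U k (?Q B) \<psi> z * cnj (apply_U k (?Q B) \<psi> z')) = apply_U k U \<psi> z * cnj (apply_U k U \<psi> z')"
      using out[OF \<psi> z] by simp
  qed
  then obtain c' where c': "eq_bv k (?Q B) (\<lambda>y x. c' B * U y x)" if "B \<in> set Bs" for B
    by metis
  define c where "c B = c' B / a" for B
  have c: "eq_bv k (columns k (column k N B) N) (\<lambda>y x. c B * U y x)" if "B \<in> set Bs" for B
    using c'[OF that] a by (simp add: eq_bv_def c_def field_simps)
  \<comment> \<open>If every scalar vanished, all branch outputs would be 0, contradicting the
    positive total weight given by \<open>sum_list_chain\<close>.\<close>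
  have "\<exists>B\<in>set Bs. c B \<noteq> 0"
  proof (rule ccontr)
    assume "\<not> ?thesis"
    then have 0: "columns k (column k N B) N y x = 0" if "B \<in> set Bs" "y \<in> bitvecs k" "x \<in> bitvecs k" for B y x
      using c[OF that(1)] that by (auto simp: eq_bv_def)
    have "(\<Sum>B\<leftarrow>Bs. \<Sum>y\<in>bitvecs k. (cmod (columns k (column k N B) N y (\<lambda>_. 0)))\<^sup>2) = (\<Sum>B\<leftarrow>Bs. 0)"
      by (intro arg_cong[where f = sum_list] map_cong refl) (simp add: 0 zero_in_bitvecs)
    then have "real (card ({1..N} \<rightarrow>\<^sub>E bitvecs (k - 1))) * (\<Prod>j\<in>{1..<N}. hs2 k bvI) = 0"
      using sum_list_chain[where G = "\<lambda>_. bvI", OF locc Bs zero_in_bitvecs assms(1) refl] by simp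
    then show False
      using card_bitvecs_pos[of k] card_bitvecs_pos[of "k - 1"] by (auto simp: card_PiE hs2_bvI)
  qed
  then obtain B where B: "B \<in> set Bs" "c B \<noteq> 0" by blast
  let ?L = "columns k (column k N B)"
  \<comment> \<open>The two end values are prescribed so that the normalised prefixes start at
    \<open>bvI\<close> and end at \<open>U\<close> itself; strictly between, any scalar from
    \<open>columns_prefix_unitary\<close> serves.\<close>
  define \<gamma> where "\<gamma> s = (if s = 0 then 1 else if s = N then c B else
      (SOME g. g \<noteq> 0 \<and> unitary_bv k (\<lambda>y x. ?L s y x / g)))" for s
  have LU: "eq_bv k (\<lambda>y x. ?L N y x / \<gamma> N) U"
    using c[OF B(1)] B(2) assms(1) by (simp add: eq_bv_def \<gamma>_def)
  have "\<gamma> s \<noteq> 0 \<and> unitary_bv k (\<lambda>y x. ?L s y x / \<gamma> s)" if "s \<le> N" for s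
  proof -
    consider "s = 0" | "s = N" "s \<noteq> 0" | "1 \<le> s" "s < N" using \<open>s \<le> N\<close> by linarith
    then show ?thesis
    proof cases
      case 1
      then show ?thesis by (simp add: \<gamma>_def unitary_bv_I)
    next
      case 2
      then show ?thesis using unitary_bv_cong[OF LU assms(2)] B(2) by (simp add: \<gamma>_def)
    next
      case 3
      then show ?thesis
        using someI_ex[OF columns_prefix_unitary[OF locc Bs assms(2) c 3 B]] by (simp add: \<gamma>_def)
    qed
  qed
  then show ?thesis using LU by (intro exI[of _ B] exI[of _ \<gamma>]) (simp add: \<gamma>_def)
qed

text \<open>\<open>mat_chain\<close> appends factors on the right whereas columns accumulate on the
  left, hence the reversal \<open>N + 1 - i\<close>. Each factor carries one prefix
  \<open>P s\<close> to the next, so the product telescopes.\<close>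

lemma mat_chain_telescope:
  assumes "\<And>s. s < N \<Longrightarrow> eq_bv k (bv_mult k (V (Suc s)) (P s)) (P (Suc s))" "n \<le> N"
  shows "eq_bv k (bv_mult k (mat_chain k (\<lambda>i. V (N + 1 - i)) n) (P (N - n))) (P N)"
  using assms(2)
proof (induction n)
  case 0
  have "mat_chain k (\<lambda>i. V (N + 1 - i)) 0 = bvI" by (simp only: mat_chain.simps bvI_def)
  then show ?case using bv_mult_I_left[of k "P N"] by (simp only: diff_zero)
next
  case (Suc n)
  have 1: "N + 1 - Suc n = Suc (N - Suc n)" and 2: "N - n = Suc (N - Suc n)" using Suc.prems by auto
  have step: "eq_bv k (bv_mult k (V (N + 1 - Suc n)) (P (N - Suc n))) (P (N - n))"
    unfolding 1 2 using Suc.prems by (intro assms(1)) simp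
  have eq: "bv_mult k (mat_chain k (\<lambda>i. V (N + 1 - i)) (Suc n)) (P (N - Suc n))
     = bv_mult k (mat_chain k (\<lambda>i. V (N + 1 - i)) n) (bv_mult k (V (N + 1 - Suc n)) (P (N - Suc n)))"
    unfolding mat_chain.simps bv_mult_assoc ..
  have "eq_bv k (bv_mult k (mat_chain k (\<lambda>i. V (N + 1 - i)) (Suc n)) (P (N - Suc n)))
      (bv_mult k (mat_chain k (\<lambda>i. V (N + 1 - i)) n) (P (N - n)))"
    unfolding eq by (rule bv_mult_cong[OF eq_bv_refl step])
  also have "eq_bv k \<dots> (P N)" by (rule Suc.IH) (use Suc.prems in simp)
  finally show ?case .
qed

text \<open>The end rows touch one vertical edge each, which is where \<open>a 0 = a k = 0\<close>
  enters; \<open>k \<ge> 2\<close> keeps rows 1 and \<open>k\<close> distinct. The scalar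
  \<open>g i\<close> is absorbed into the first tensor factor.\<close>

lemma cluster_factor_column:
  assumes "k \<ge> 2"
  shows "cluster_factor k (\<lambda>i m r c. g i * site k N B 1 (h i) r c 0 m) (\<lambda>r i m n y x. site k N B r (h i) y x m n)
      (\<lambda>i m r c. site k N B k (h i) r c m 0) i
    = (\<lambda>y x. g i * column k N B (h i) y x)"
proof (intro ext)
  fix y x
  have "(\<Prod>r\<in>{1..k}. site k N B r (h i) (y r) (x r) (a (r - 1)) (a r))
    = site k N B 1 (h i) (y 1) (x 1) 0 (a 1) * (\<Prod>r\<in>{2..k - 1}. site k N B r (h i) (y r) (x r) (a (r - 1)) (a r))
      * site k N B k (h i) (y k) (x k) (a (k - 1)) 0" if "a \<in> bitvecs (k - 1)" for a
  proof -
    have "{1..k} = insert 1 (insert k {2..k - 1})" using assms by auto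
    moreover have "a 0 = 0" "a k = 0" using that assms by (auto simp: bitvecs_def)
    ultimately show ?thesis using assms by (simp add: mult_ac)
  qed
  then show "cluster_factor k (\<lambda>i m r c. g i * site k N B 1 (h i) r c 0 m) (\<lambda>r i m n y x. site k N B r (h i) y x m n)
      (\<lambda>i m r c. site k N B k (h i) r c m 0) i y x = g i * column k N B (h i) y x"
    unfolding cluster_factor_def column_def sum_distrib_left by (intro sum.cong refl) (simp add: mult.assoc)
qed

theorem theorem1:
  fixes k N :: nat and U :: "bv \<Rightarrow> bv \<Rightarrow> complex"
  assumes "k \<ge> 2" and "N \<ge> 1"
    and "unitary_bv k U"
    and "det_implementable k N U"
  shows "\<exists>E1 Emid Ek.
           (\<forall>i. 1 \<le> i \<and> i \<le> N \<longrightarrow> unitary_bv k (cluster_factor k E1 Emid Ek i))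
         \<and> (\<forall>y\<in>bitvecs k. \<forall>x\<in>bitvecs k.
              U y x = mat_chain k (cluster_factor k E1 Emid Ek) N y x)"
proof -
  obtain B \<gamma> where \<gamma>: "\<And>s. s \<le> N \<Longrightarrow> \<gamma> s \<noteq> 0"
    and unit: "\<And>s. s \<le> N \<Longrightarrow> unitary_bv k (\<lambda>y x. columns k (column k N B) s y x / \<gamma> s)"
    and \<gamma>0: "\<gamma> 0 = 1" and LU: "eq_bv k (\<lambda>y x. columns k (column k N B) N y x / \<gamma> N) U"
    using det_implementable_columns[OF assms(2-4)] by metis
  define P where "P s = (\<lambda>y x. columns k (column k N B) s y x / \<gamma> s)" for s
  \<comment> \<open>This ratio makes \<open>V j\<close> carry the normalised prefix
    \<open>P (j - 1)\<close> to \<open>P j\<close>.\<close>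
  define V where "V j = (\<lambda>y x. \<gamma> (j - 1) / \<gamma> j * column k N B j y x)" for j
  have step: "eq_bv k (bv_mult k (V (Suc s)) (P s)) (P (Suc s))" if "s < N" for s
  proof -
    have "bv_mult k (V (Suc s)) (P s) = (\<lambda>y x. bv_mult k (column k N B (Suc s)) (columns k (column k N B) s) y x / \<gamma> (Suc s))"
      using \<gamma>[of s] that by (intro ext) (simp add: bv_mult_def V_def P_def sum_divide_distrib)
    moreover have "eq_bv k (bv_mult k (column k N B (Suc s)) (columns k (column k N B) s)) (columns k (column k N B) (Suc s))"
      unfolding chain.simps by (rule bv_mult_cong[OF eq_bv_sym[OF bv_mult_I_right] eq_bv_refl])
    ultimately show ?thesis by (simp add: eq_bv_def P_def del: chain.simps)
  qed
  \<comment> \<open>As the quotient of the unitary prefixes \<open>P j\<close> and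
    \<open>P (j - 1)\<close>, the factor \<open>V j\<close> is unitary.\<close>
  have V: "unitary_bv k (V j)" if "1 \<le> j" "j \<le> N" for j
  proof -
    obtain s where s: "j = Suc s" using \<open>1 \<le> j\<close> by (cases j) auto
    show ?thesis
      unfolding s by (rule unitary_bv_left_quotient[OF _ _ step]) (use unit that in \<open>simp_all add: P_def s del: chain.simps\<close>)
  qed
  have "eq_bv k (mat_chain k (\<lambda>i. V (N + 1 - i)) N) (bv_mult k (mat_chain k (\<lambda>i. V (N + 1 - i)) N) bvI)"
    by (rule eq_bv_sym[OF bv_mult_I_right])
  also have "bvI = P (N - N)" by (simp add: P_def \<gamma>0)
  also have "eq_bv k (bv_mult k (mat_chain k (\<lambda>i. V (N + 1 - i)) N) (P (N - N))) (P N)"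
    by (rule mat_chain_telescope[where V = V and P = P and N = N, OF step]) auto
  also have "eq_bv k (P N) U" unfolding P_def by (rule LU)
  finally have chain: "eq_bv k (mat_chain k (\<lambda>i. V (N + 1 - i)) N) U" .
  let ?F = "cluster_factor k (\<lambda>i m r c. \<gamma> (N + 1 - i - 1) / \<gamma> (N + 1 - i) * site k N B 1 (N + 1 - i) r c 0 m)
    (\<lambda>r i m n y x. site k N B r (N + 1 - i) y x m n) (\<lambda>i m r c. site k N B k (N + 1 - i) r c m 0)"
  have F: "?F = (\<lambda>i. V (N + 1 - i))"
    by (rule ext) (simp only: V_def cluster_factor_column[OF assms(1)])
  have "unitary_bv k (?F i)" if "1 \<le> i" "i \<le> N" for i
    unfolding F using V[of "N + 1 - i"] that by auto
  moreover have "\<forall>y\<in>bitvecs k. \<forall>x\<in>bitvecs k. U y x = mat_chain k ?F N y x"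
    unfolding F using chain by (simp add: eq_bv_def)
  ultimately show ?thesis by blast
qed

end
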